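(* Let $f\in F_r$, $\beta>0$, $\varphi\in(0,1)$, and let $h:(0,1)\to\mathbb R_+$ satisfy $h(\varepsilon)=O(\varepsilon^{1/(r+1)})$ as $\varepsilon\to0^+$. Then for all sufficiently small $\varepsilon>0$ the approximations $l_{i,r+1}$ computed by the algorithm ADAPT-MESH on its mesh $a=x_0^*<x_1^*<\dots<x_{m^*}^*=b$ satisfy $$\sup_{t\in[x_i^*,x_{i+1}^*]}\|z_i(t)-l_{i,r+1}(t)\|\le\varepsilon,\qquad i=0,1,\dots,m^*-1,$$ where $z_i$ is the local solution given by $z_i'(t)=f(t,z_i(t))$, $z_i(x_i^* )=y_i^*$.
   Context: **Problem.** Let $a<b$, $d,r\ge1$ integers, $\eta\in\mathbb R^d$, $\|\cdot\|$ the maximum norm in $\mathbb R^d$. Consider $z'(t)=f(t,z(t))$, $t\in[a,b]$, $z(a)=\eta$. $F_r$ is the class of continuous $f:[a,b]\times\mathbb R^d\to\mathbb R^d$ such that for some $L\ge0$, $\|f(t,y)-f(t,\bar y)\|\le L\|y-\bar y\|$ for all $t\in[a,b]$, $y,\bar y\in\mathbb R^d$, and $f\in C^r([a,b]\times D)$, where $D=\{y\in\mathbb R^d:\|y\|\le\sup_{t\in[a,b]}\|z(t)\|+1\}$ and $z$ is the unique solution. **Basic iteration.** Given an interval $[\sigma,\tau]$, a vector $y$ and nodes $s_0,\dots,s_{r-1}\in[\sigma,\tau]$: put $l_0\equiv y$; given $l_j$, let $q_j$ be the Lagrange interpolation polynomial of degree at most $r-1$ of $t\mapsto f(t,l_j(t))$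 at $s_0,\dots,s_{r-1}$, and $l_{j+1}(t)=y+\int_\sigma^tq_j(\xi)\,d\xi$. The output is $l_{r+1}$. **Algorithm ADAPT-MESH** (parameters $\varepsilon\in(0,1)$, $\beta>0$, $\varphi\in(0,1)$, function $h$). Set $x_0^*=a$, $y_0^*=\eta$. Given $x_i^*<b$ and $y_i^*$: (1) $\bar x_{i+1}=x_i^*+\min\{h(\varepsilon),b-x_i^*\}$; let $\bar t_0=x_i^*,\bar t_1,\dots,\bar t_r=\bar x_{i+1}$ be equidistant. (2) Let $\bar l_{i,r+1}$ be the output of the basic iteration on $[x_i^*,\bar x_{i+1}]$ with $y=y_i^*$ and nodes $\bar t_0,\dots,\bar t_{r-1}$. (3) With $\tilde H_i(t)=f(t,\bar l_{i,r+1}(t))$ compute componentwise the divided difference $\tilde H_i[\bar t_0,\dots,\bar t_r]$ and $G_i=\frac83\bigl(\|\tilde H_i[\bar t_0,\dots,\bar t_r]\|+\beta\bigr)(1+\varphi)$. (4) $x_{i+1}^*=x_i^*+\min\{(\varepsilon/G_i)^{1/(r+1)},\,b-x_i^*\}$; let $t_0,\dots,t_{r-1}$ be equidistant in $[x_i^*,x_{i+1}^*]$ with $t_0=x_i^*$ if $r=1$, and $t_0=x_i^*$, $t_{r-1}=x_{i+1}^*$ if $r\ge2$. (5) Let $l_{i,r+1}$ be the output of the basic iteration on $[x_i^*,x_{i+1}^*]$ with $y=y_i^*$ and nodes $t_0,\dots,t_{r-1}$; set $y_{i+1}^*=l_{i,r+1}(x_{i+1}^* )$. Stop if $x_{i+1}^*=b$;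 otherwise continue with $i+1$. $m^*=m^*(\varepsilon)$ is the number of subintervals produced. The threshold for "sufficiently small" may depend on $f,\beta,\varphi,h$ and the problem data. *)

theory Defs
  imports "HOL-Analysis.Analysis" "HOL-Library.Landau_Symbols"
begin

(* Functions on [a,b] x R^d are total functions on real => real^'d; their values for t outside
   [a,b] are never used. The maximum norm on real^'d is infnorm. *)

(* C^k on a set: the derivative within S exists and all its directional components are C^(k-1).
   Used on [a,b] x D only, a convex set with non-empty interior, where the derivative within the
   set is unique (one-sided at the boundary). *)
primrec Ck_on :: "nat \<Rightarrow> ('a::euclidean_space \<Rightarrow> 'b::euclidean_space) \<Rightarrow> 'a set \<Rightarrow> bool" where
  "Ck_on 0 g S \<longleftrightarrow> continuous_on S g"
| "Ck_on (Suc k) g S \<longleftrightarrow>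
     (\<exists>g'. (\<forall>x\<in>S. (g has_derivative g' x) (at x within S)) \<and> (\<forall>v. Ck_on k (\<lambda>x. g' x v) S))"

definition solves_ivp ::
  "(real \<Rightarrow> real^'d \<Rightarrow> real^'d) \<Rightarrow> real \<Rightarrow> real \<Rightarrow> real^'d \<Rightarrow> (real \<Rightarrow> real^'d) \<Rightarrow> bool" where
  "solves_ivp f s e y z \<longleftrightarrow>
     z s = y \<and> (\<forall>t\<in>{s..e}. (z has_vector_derivative f t (z t)) (at t within {s..e}))"

(* The Lipschitz condition makes the solution z exist and be unique on [a,b]. *)
definition class_F :: "real \<Rightarrow> real \<Rightarrow> real^'d \<Rightarrow> nat \<Rightarrow> (real \<Rightarrow> real^'d \<Rightarrow> real^'d) set" where
  "class_F a b \<eta> r = {f.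
     continuous_on ({a..b} \<times> UNIV) (\<lambda>(t, y). f t y) \<and>
     (\<exists>L\<ge>0. \<forall>t\<in>{a..b}. \<forall>y y'. infnorm (f t y - f t y') \<le> L * infnorm (y - y')) \<and>
     (\<exists>z. solves_ivp f a b \<eta> z \<and>
        Ck_on r (\<lambda>(t, y). f t y)
          ({a..b} \<times> {y. infnorm y \<le> (SUP t\<in>{a..b}. infnorm (z t)) + 1}))}"

(* Lagrange polynomial of degree at most r-1 of g at the nodes s 0, ..., s (r-1), componentwise *)
definition lagrange_interp ::
  "nat \<Rightarrow> (nat \<Rightarrow> real) \<Rightarrow> (real \<Rightarrow> real^'d) \<Rightarrow> real \<Rightarrow> real^'d" where
  "lagrange_interp r s g \<xi> =
     (\<Sum>k<r. (\<Prod>j\<in>{..<r} - {k}. (\<xi> - s j) / (s k - s j)) *\<^sub>R g (s k))"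

primrec iterate ::
  "(real \<Rightarrow> real^'d \<Rightarrow> real^'d) \<Rightarrow> nat \<Rightarrow> (nat \<Rightarrow> real) \<Rightarrow> real \<Rightarrow> real^'d \<Rightarrow> nat \<Rightarrow> real \<Rightarrow> real^'d" where
  "iterate f r s \<sigma> y 0 = (\<lambda>t. y)"
| "iterate f r s \<sigma> y (Suc j) =
     (\<lambda>t. y + integral {\<sigma>..t} (lagrange_interp r s (\<lambda>\<xi>. f \<xi> (iterate f r s \<sigma> y j \<xi>))))"

definition basic_iteration ::
  "(real \<Rightarrow> real^'d \<Rightarrow> real^'d) \<Rightarrow> nat \<Rightarrow> (nat \<Rightarrow> real) \<Rightarrow> real \<Rightarrow> real^'d \<Rightarrow> real \<Rightarrow> real^'d" where
  "basic_iteration f r s \<sigma> y = iterate f r s \<sigma> y (r + 1)"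

(* divdiff g t k i = g[t i, ..., t (i+k)] *)
primrec divdiff :: "(real \<Rightarrow> real^'d) \<Rightarrow> (nat \<Rightarrow> real) \<Rightarrow> nat \<Rightarrow> nat \<Rightarrow> real^'d" where
  "divdiff g t 0 i = g (t i)"
| "divdiff g t (Suc k) i =
     (1 / (t (i + Suc k) - t i)) *\<^sub>R (divdiff g t k (Suc i) - divdiff g t k i)"

definition trial_node :: "nat \<Rightarrow> real \<Rightarrow> real \<Rightarrow> nat \<Rightarrow> real" where
  "trial_node r \<sigma> \<tau> j = \<sigma> + real j * (\<tau> - \<sigma>) / real r"

definition node :: "nat \<Rightarrow> real \<Rightarrow> real \<Rightarrow> nat \<Rightarrow> real" where
  "node r \<sigma> \<tau> j = (if r = 1 then \<sigma> else \<sigma> + real j * (\<tau> - \<sigma>) / real (r - 1))"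

definition trial_end :: "real \<Rightarrow> (real \<Rightarrow> real) \<Rightarrow> real \<Rightarrow> real \<Rightarrow> real" where
  "trial_end b h \<epsilon> x = x + min (h \<epsilon>) (b - x)"

definition mesh_G ::
  "(real \<Rightarrow> real^'d \<Rightarrow> real^'d) \<Rightarrow> real \<Rightarrow> nat \<Rightarrow> real \<Rightarrow> real \<Rightarrow> (real \<Rightarrow> real) \<Rightarrow> real
    \<Rightarrow> real \<Rightarrow> real^'d \<Rightarrow> real" where
  "mesh_G f b r \<beta> \<phi> h \<epsilon> x y =
     (let t = trial_node r x (trial_end b h \<epsilon> x);
          l = basic_iteration f r t x y;
          H = (\<lambda>t. f t (l t))
      in 8 / 3 * (infnorm (divdiff H t r 0) + \<beta>) * (1 + \<phi>))"

definition next_x ::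
  "(real \<Rightarrow> real^'d \<Rightarrow> real^'d) \<Rightarrow> real \<Rightarrow> nat \<Rightarrow> real \<Rightarrow> real \<Rightarrow> (real \<Rightarrow> real) \<Rightarrow> real
    \<Rightarrow> real \<Rightarrow> real^'d \<Rightarrow> real" where
  "next_x f b r \<beta> \<phi> h \<epsilon> x y =
     x + min ((\<epsilon> / mesh_G f b r \<beta> \<phi> h \<epsilon> x y) powr (1 / (real r + 1))) (b - x)"

definition local_approx ::
  "(real \<Rightarrow> real^'d \<Rightarrow> real^'d) \<Rightarrow> real \<Rightarrow> nat \<Rightarrow> real \<Rightarrow> real \<Rightarrow> (real \<Rightarrow> real) \<Rightarrow> real
    \<Rightarrow> real \<Rightarrow> real^'d \<Rightarrow> real \<Rightarrow> real^'d" where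
  "local_approx f b r \<beta> \<phi> h \<epsilon> x y =
     basic_iteration f r (node r x (next_x f b r \<beta> \<phi> h \<epsilon> x y)) x y"

(* The pair (x*_i, y*_i); constant once b is reached, where the algorithm stops. *)
primrec adapt_mesh ::
  "(real \<Rightarrow> real^'d \<Rightarrow> real^'d) \<Rightarrow> real \<Rightarrow> real \<Rightarrow> real^'d \<Rightarrow> nat \<Rightarrow> real \<Rightarrow> real \<Rightarrow> (real \<Rightarrow> real)
    \<Rightarrow> real \<Rightarrow> nat \<Rightarrow> real \<times> (real^'d)" where
  "adapt_mesh f a b \<eta> r \<beta> \<phi> h \<epsilon> 0 = (a, \<eta>)"
| "adapt_mesh f a b \<eta> r \<beta> \<phi> h \<epsilon> (Suc i) =
     (let (x, y) = adapt_mesh f a b \<eta> r \<beta> \<phi> h \<epsilon> i;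
          x' = next_x f b r \<beta> \<phi> h \<epsilon> x y
      in if x < b then (x', local_approx f b r \<beta> \<phi> h \<epsilon> x y x') else (x, y))"

end

theory Submission
  imports Defs "HOL-Computational_Algebra.Polynomial"
begin

text \<open>
  Fix a mesh point \<open>x\<close>, the computed value \<open>y\<close> there, and let \<open>u\<close> be the exact solution through
  \<open>(x, y)\<close>. As long as \<open>y\<close> is within \<open>1/2\<close> of the global solution, \<open>u\<close> stays for a short time in the
  region where \<open>f\<close> is \<open>C^r\<close>. Then \<open>u' = f(t, u)\<close> is itself \<open>C^r\<close>, and its derivatives are given by
  fixed continuous functions of \<open>(t, u(t))\<close> on a compact set; hence \<open>u^(r+1)\<close> is bounded and
  equicontinuous, uniformly over all such local solutions
  (\<open>Ck_on_flow_derivs\<close>, \<open>class_F_smooth_local_solutions\<close>). This replaces any differentiation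
  of \<open>t \<mapsto> f(t, l(t))\<close> along the computed polynomials \<open>l\<close>.

  On a step of length \<open>d\<close>, each sweep of the basic iteration gains one order, so that after \<open>r\<close>
  sweeps the error is \<open>O(d^(r+1))\<close>. In the last sweep the only term not of higher order is the
  integral of the interpolation error of \<open>u'\<close>; since the nodal polynomial is at most \<open>d^r\<close>, it is
  at most \<open>A d^(r+1)\<close> with \<open>A\<close> the maximum norm of \<open>u^(r+1) / r!\<close> over the step
  (\<open>basic_iteration_error\<close>). Likewise \<open>f(t, l(t)) = u'(t) + O(d^(r+1))\<close> along the output \<open>l\<close> of the
  trial step, now with \<open>d\<close> the length of that step, and an \<open>r\<close>-th divided difference costs only
  \<open>d^(-r)\<close>. So the computed divided difference is an \<open>r\<close>-th divided difference of \<open>u'\<close> up to \<open>O(d)\<close>,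
  that is, componentwise a value of \<open>u^(r+1) / r!\<close> up to \<open>o(1)\<close> (\<open>trial_divdiff_close\<close>,
  \<open>divdiff_derivative\<close>). Once the steps are so short that all these remainders add up to at most
  \<open>\<beta>\<close>, the local error is bounded by (computed divided difference \<open>+ \<beta>\<close>) \<open>d^(r+1) \<le> G d^(r+1) \<le> \<epsilon>\<close>
  (\<open>adaptive_step_error\<close>, \<open>mesh_step\<close>).

  It remains to see that \<open>y\<close> never leaves the tube around the global solution and that \<open>b\<close> is
  reached. The local error is also at most a constant times \<open>\<delta> d\<close>, where \<open>\<delta>\<close> bounds the step
  lengths; with Lipschitz propagation these errors accumulate to \<open>O(\<delta>)\<close>, uniformly in the number of
  steps. And \<open>G\<close> is bounded above, so for fixed \<open>\<epsilon>\<close> all steps except the last exceed a positive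
  constant.
\<close>

section \<open>Differential inequalities in the maximum norm\<close>

lemma infnorm_le_iff:
  fixes v :: "'a::euclidean_space"
  shows "infnorm v \<le> c \<longleftrightarrow> (\<forall>b\<in>Basis. \<bar>v \<bullet> b\<bar> \<le> c)"
  by (auto simp: infnorm_Max)

lemma infnorm_sum_le:
  fixes g :: "'i \<Rightarrow> 'a::euclidean_space"
  assumes "\<And>i. i \<in> I \<Longrightarrow> infnorm (g i) \<le> c i"
  shows "infnorm (sum g I) \<le> sum c I"
  using assms
proof (induction I rule: infinite_finite_induct)
  case (insert i I)
  then show ?case
    using infnorm_triangle[of "g i" "sum g I"] by (auto intro: order_trans add_mono)
qed (auto simp: infnorm_0)

lemma infnorm_triangle_sub:
  fixes u v w :: "'a::euclidean_space"
  shows "infnorm (u - w) \<le> infnorm (u - v) + infnorm (v - w)"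
  using infnorm_triangle[of "u - v" "v - w"] by simp

lemma infnorm_le_add_diff:
  fixes u v :: "'a::euclidean_space"
  shows "infnorm u \<le> infnorm v + infnorm (u - v)"
  using infnorm_triangle[of v "u - v"] by simp

lemma has_real_derivative_inner_component:
  fixes v :: "real \<Rightarrow> 'a::euclidean_space"
  assumes "(v has_vector_derivative v') (at t within S)"
  shows "((\<lambda>t. v t \<bullet> b) has_real_derivative v' \<bullet> b) (at t within S)"
  using bounded_linear.has_vector_derivative[OF bounded_linear_inner_left assms]
  by (simp add: has_real_derivative_iff_has_vector_derivative)

text \<open>
  The mean value theorem holds with constant one in the maximum norm because it can be applied
  to each component separately.
\<close>
lemma infnorm_increment_le:
  fixes v :: "real \<Rightarrow> 'a::euclidean_space"
  assumes der: "\<And>t. t \<in> {s..e} \<Longrightarrow> (v has_vector_derivative v' t) (at t within {s..e})"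
    and bound: "\<And>t. t \<in> {s..e} \<Longrightarrow> infnorm (v' t) \<le> M"
    and t: "t \<in> {s..e}"
  shows "infnorm (v t - v s) \<le> M * (t - s)"
  unfolding infnorm_le_iff
proof
  fix b :: 'a assume b: "b \<in> Basis"
  have "((\<lambda>t. v t \<bullet> b) has_derivative (\<lambda>h. (v' x \<bullet> b) * h)) (at x within {s..t})"
    if "s \<le> x" "x \<le> t" for x
    using has_real_derivative_inner_component[OF der, of x b] that t
    by (auto simp: has_field_derivative_def intro: has_derivative_subset)
  then obtain x where x: "x \<in> {s..t}" "v t \<bullet> b - v s \<bullet> b = (v' x \<bullet> b) * (t - s)"
    using mvt_very_simple[of s t "\<lambda>t. v t \<bullet> b" "\<lambda>x h. (v' x \<bullet> b) * h"] t by auto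
  have "\<bar>v' x \<bullet> b\<bar> \<le> M"
    using bound[of x] x t b by (auto simp: infnorm_le_iff)
  then show "\<bar>(v t - v s) \<bullet> b\<bar> \<le> M * (t - s)"
    using x t by (simp add: inner_diff_left abs_mult mult_right_mono)
qed

text \<open>
  On an interval with \<open>L (e - s) \<le> 1/2\<close> Gronwall's inequality needs no integration: at a maximum
  point of \<open>infnorm v\<close> the bound on the derivative can be absorbed. The factor \<open>1 + 2 L (e - s)\<close> is
  at most \<open>exp (2 L (e - s))\<close>, so products over many short intervals stay bounded.
\<close>
lemma infnorm_gronwall_short:
  fixes v :: "real \<Rightarrow> 'a::euclidean_space"
  assumes der: "\<And>t. t \<in> {s..e} \<Longrightarrow> (v has_vector_derivative v' t) (at t within {s..e})"
    and bound: "\<And>t. t \<in> {s..e} \<Longrightarrow> infnorm (v' t) \<le> L * infnorm (v t) + M"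
    and L: "L \<ge> 0" and M: "M \<ge> 0" and short: "L * (e - s) \<le> 1 / 2"
    and t: "t \<in> {s..e}"
  shows "infnorm (v t) \<le> (1 + 2 * L * (e - s)) * (infnorm (v s) + M * (e - s))"
proof -
  define q where "q = L * (e - s)"
  have q: "0 \<le> q" "q \<le> 1 / 2"
    using L short t by (auto simp: q_def)
  have "continuous_on {s..e} (\<lambda>t. infnorm (v t))"
    using der by (intro continuous_intros continuous_on_vector_derivative)
  then obtain T where T: "T \<in> {s..e}" "\<And>x. x \<in> {s..e} \<Longrightarrow> infnorm (v x) \<le> infnorm (v T)"
    using continuous_attains_sup[of "{s..e}" "\<lambda>t. infnorm (v t)"] t by auto
  define E where "E = infnorm (v T)"
  have E0: "E \<ge> 0" by (simp add: E_def infnorm_pos_le)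
  define c where "c = infnorm (v s) + M * (e - s)"
  have c0: "c \<ge> 0" using M t by (simp add: c_def infnorm_pos_le)
  have "infnorm (v T - v s) \<le> (L * E + M) * (T - s)"
  proof (rule infnorm_increment_le[OF der _ T(1)])
    fix x assume "x \<in> {s..e}"
    then show "infnorm (v' x) \<le> L * E + M"
      using bound[of x] T(2)[of x] L unfolding E_def
      by (meson add_right_mono mult_left_mono order_trans)
  qed auto
  also have "\<dots> \<le> (L * E + M) * (e - s)"
    using T(1) L E0 M by (intro mult_left_mono) auto
  finally have "infnorm (v T - v s) \<le> q * E + M * (e - s)"
    by (simp add: q_def algebra_simps)
  then have Ec: "E * (1 - q) \<le> c"
    using infnorm_le_add_diff[of "v T" "v s"] by (simp add: E_def c_def algebra_simps)
  have "1 \<le> (1 + 2 * q) * (1 - q)"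
  proof -
    have "q * q \<le> q * (1 / 2)" using q by (intro mult_left_mono)
    then show ?thesis by (simp add: algebra_simps)
  qed
  then have "E \<le> E * ((1 + 2 * q) * (1 - q))"
    using E0 by (metis mult.right_neutral mult_left_mono)
  also have "\<dots> \<le> (1 + 2 * q) * c"
    using mult_left_mono[OF Ec, of "1 + 2 * q"] q by (simp add: algebra_simps)
  finally show ?thesis
    using T(2)[OF t] by (simp add: E_def q_def c_def mult.assoc)
qed

section \<open>Local existence and stability\<close>

text \<open>
  Banach's fixed point theorem for the Picard operator. To work in the space of bounded continuous
  functions on the whole line, the operator is extended constantly outside \<open>[s, e]\<close> by clamping its
  argument.
\<close>
lemma picard_short:
  fixes f :: "real \<Rightarrow> real^'d \<Rightarrow> real^'d"
  assumes se: "s \<le> e"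
    and cont: "continuous_on ({s..e} \<times> UNIV) (\<lambda>(t, y). f t y)"
    and lip: "\<And>t y y'. t \<in> {s..e} \<Longrightarrow> norm (f t y - f t y') \<le> L * norm (y - y')"
    and L: "L \<ge> 0" and short: "L * (e - s) \<le> 1 / 2"
  shows "\<exists>u. solves_ivp f s e y u"
proof -
  define c where "c = (\<lambda>t. max s (min e t))"
  have c: "c t \<in> {s..e}" "t \<in> {s..e} \<Longrightarrow> c t = t" for t
    using se by (auto simp: c_def)
  have contc: "continuous_on UNIV c"
    unfolding c_def by (intro continuous_intros)
  define T where "T = (\<lambda>\<psi> t. y + integral {s..c t} (\<lambda>\<tau>. f \<tau> (\<psi> \<tau>)))"
  have cf: "continuous_on {s..e} (\<lambda>\<tau>. f \<tau> (\<psi> \<tau>))" if "continuous_on {s..e} \<psi>" for \<psi>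
  proof -
    have "continuous_on {s..e} (\<lambda>\<tau>. (\<tau>, \<psi> \<tau>))"
      using that by (intro continuous_intros)
    then show ?thesis
      using continuous_on_compose2[OF cont, of "{s..e}" "\<lambda>\<tau>. (\<tau>, \<psi> \<tau>)"] by auto
  qed
  have TB: "T \<psi> \<in> bcontfun" if \<psi>: "continuous_on {s..e} \<psi>" for \<psi>
  proof -
    define I where "I = (\<lambda>t. y + integral {s..t} (\<lambda>\<tau>. f \<tau> (\<psi> \<tau>)))"
    have I: "continuous_on {s..e} I" unfolding I_def
      by (intro continuous_intros indefinite_integral_continuous_1 integrable_continuous_real cf \<psi>)
    have TI: "T \<psi> = (\<lambda>t. I (c t))" by (simp add: T_def I_def fun_eq_iff)
    have "continuous_on UNIV (T \<psi>)"
      unfolding TI by (rule continuous_on_compose2[OF I contc]) (use c in auto)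
    moreover have "range (T \<psi>) \<subseteq> I ` {s..e}" using c TI by auto
    then have "bounded (range (T \<psi>))"
      using compact_imp_bounded[OF compact_continuous_image[OF I compact_Icc]] bounded_subset
      by blast
    ultimately show ?thesis by (simp add: bcontfun_def)
  qed
  define F where "F = (\<lambda>\<psi> :: real \<Rightarrow>\<^sub>C (real^'d). Bcontfun (T (apply_bcontfun \<psi>)))"
  have F: "apply_bcontfun (F \<psi>) = T (apply_bcontfun \<psi>)" for \<psi>
    unfolding F_def by (rule Bcontfun_inverse[OF TB]) simp
  have "dist (F \<psi>) (F \<psi>') \<le> 1 / 2 * dist \<psi> \<psi>'" for \<psi> \<psi>'
  proof (rule dist_bound)
    fix t
    have int: "(\<lambda>\<tau>. f \<tau> (apply_bcontfun \<psi> \<tau>)) integrable_on {s..c t}" for \<psi> :: "real \<Rightarrow>\<^sub>C (real^'d)"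
      using c(1)[of t] by (intro integrable_continuous_real continuous_on_subset[OF cf]) auto
    have "dist (F \<psi> t) (F \<psi>' t)
        = norm (integral {s..c t} (\<lambda>\<tau>. f \<tau> (\<psi> \<tau>) - f \<tau> (\<psi>' \<tau>)))"
      by (simp add: F T_def dist_norm integral_diff int)
    also have "\<dots> \<le> (L * dist \<psi> \<psi>') * (c t - s)"
    proof (rule integral_bound)
      fix \<tau> assume "\<tau> \<in> {s..c t}"
      then have "\<tau> \<in> {s..e}" using c(1)[of t] by auto
      then have "norm (f \<tau> (\<psi> \<tau>) - f \<tau> (\<psi>' \<tau>)) \<le> L * dist (\<psi> \<tau>) (\<psi>' \<tau>)"
        using lip by (simp add: dist_norm)
      also have "\<dots> \<le> L * dist \<psi> \<psi>'"
        using L dist_bounded by (intro mult_left_mono) auto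
      finally show "norm (f \<tau> (\<psi> \<tau>) - f \<tau> (\<psi>' \<tau>)) \<le> L * dist \<psi> \<psi>'" .
    qed (use c(1)[of t] in \<open>auto intro!: continuous_intros continuous_on_subset[OF cf]\<close>)
    also have "\<dots> \<le> (L * dist \<psi> \<psi>') * (e - s)"
      using c(1)[of t] L by (intro mult_left_mono) auto
    also have "\<dots> = (L * (e - s)) * dist \<psi> \<psi>'" by simp
    also have "\<dots> \<le> 1 / 2 * dist \<psi> \<psi>'"
      using short by (intro mult_right_mono) auto
    finally show "dist (F \<psi> t) (F \<psi>' t) \<le> 1 / 2 * dist \<psi> \<psi>'" .
  qed
  then obtain \<psi> where \<psi>: "F \<psi> = \<psi>"
    using banach_fix_type[of "1/2" F] by auto
  define u where "u = (\<lambda>t. y + integral {s..t} (\<lambda>\<tau>. f \<tau> (\<psi> \<tau>)))"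
  have u: "\<psi> t = u t" if "t \<in> {s..e}" for t
    using arg_cong[OF \<psi>, of "\<lambda>g. apply_bcontfun g t"] that c(2) by (simp add: F T_def u_def)
  have "(u has_vector_derivative f t (u t)) (at t within {s..e})" if t: "t \<in> {s..e}" for t
  proof -
    have "(u has_vector_derivative 0 + f t (\<psi> t)) (at t within {s..e})"
      unfolding u_def
      by (intro has_vector_derivative_add has_vector_derivative_const
          integral_has_vector_derivative[OF cf t]) simp
    then show ?thesis using u[OF t] by simp
  qed
  moreover have "u s = y" by (simp add: u_def)
  ultimately show ?thesis unfolding solves_ivp_def by blast
qed

lemma solves_ivp_restrict:
  "solves_ivp f a b \<eta> z \<Longrightarrow> a \<le> x \<Longrightarrow> e \<le> b \<Longrightarrow> solves_ivp f x e (z x) z"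
  unfolding solves_ivp_def
  by (auto intro: has_vector_derivative_within_subset[where T = "{x..e}" and S = "{a..b}"])

lemma solves_ivp_stability:
  fixes f :: "real \<Rightarrow> real^'d \<Rightarrow> real^'d"
  assumes u: "solves_ivp f s e y u" and v: "solves_ivp f s e y' v"
    and lip: "\<And>t y y'. t \<in> {s..e} \<Longrightarrow> infnorm (f t y - f t y') \<le> L * infnorm (y - y')" and L: "L \<ge> 0"
    and short: "L * (e - s) \<le> 1 / 2" and t: "t \<in> {s..e}"
  shows "infnorm (u t - v t) \<le> (1 + 2 * L * (e - s)) * infnorm (y - y')"
proof -
  have "infnorm (u t - v t) \<le> (1 + 2 * L * (e - s)) * (infnorm (u s - v s) + 0 * (e - s))"
    by (rule infnorm_gronwall_short[where v = "\<lambda>t. u t - v t", OF has_vector_derivative_diff _ L _ short t])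
       (use u v lip in \<open>auto simp: solves_ivp_def\<close>)
  then show ?thesis using u v by (simp add: solves_ivp_def)
qed

section \<open>Derivatives along solutions\<close>

lemma Ck_on_imp_continuous_on: "Ck_on k g S \<Longrightarrow> continuous_on S g"
  by (cases k) (auto intro: has_derivative_continuous_on)

lemma Ck_on_Suc_imp: "Ck_on (Suc k) g S \<Longrightarrow> Ck_on k g S"
proof (induction k arbitrary: g)
  case 0
  then show ?case by (simp del: Ck_on.simps(2) add: Ck_on_imp_continuous_on)
next
  case (Suc k)
  from Suc.prems obtain g' where g': "\<forall>x\<in>S. (g has_derivative g' x) (at x within S)"
    "\<And>v. Ck_on (Suc k) (\<lambda>x. g' x v) S"
    by (subst (asm) Ck_on.simps(2)) blast
  then have "\<forall>v. Ck_on k (\<lambda>x. g' x v) S" using Suc.IH by blast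
  with g'(1) show ?case unfolding Ck_on.simps(2) by blast
qed

lemma Ck_on_const: "Ck_on k (\<lambda>x. c) S"
proof (induction k arbitrary: c)
  case (Suc k)
  show ?case unfolding Ck_on.simps(2)
    by (rule exI[of _ "\<lambda>x v. 0"]) (use Suc in auto)
qed simp

lemma Ck_on_add: "Ck_on k g S \<Longrightarrow> Ck_on k h S \<Longrightarrow> Ck_on k (\<lambda>x. g x + h x) S"
proof (induction k arbitrary: g h)
  case (Suc k)
  from Suc.prems obtain g' h' where
    "\<forall>x\<in>S. (g has_derivative g' x) (at x within S)" "\<And>v. Ck_on k (\<lambda>x. g' x v) S"
    "\<forall>x\<in>S. (h has_derivative h' x) (at x within S)" "\<And>v. Ck_on k (\<lambda>x. h' x v) S"
    by auto
  then show ?case unfolding Ck_on.simps(2)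
    by (intro exI[of _ "\<lambda>x v. g' x v + h' x v"])
       (auto intro!: has_derivative_add Suc.IH)
qed (simp add: continuous_on_add)

lemma Ck_on_sum:
  "(\<And>i. i \<in> I \<Longrightarrow> Ck_on k (g i) S) \<Longrightarrow> Ck_on k (\<lambda>x. \<Sum>i\<in>I. g i x) S"
  by (induction I rule: infinite_finite_induct) (simp_all add: Ck_on_const Ck_on_add)

lemma Ck_on_bounded_linear:
  assumes "bounded_linear A"
  shows "Ck_on k g S \<Longrightarrow> Ck_on k (\<lambda>x. A (g x)) S"
proof (induction k arbitrary: g)
  case 0
  then show ?case using bounded_linear.continuous_on[OF assms] by simp
next
  case (Suc k)
  from Suc.prems obtain g' where
    "\<forall>x\<in>S. (g has_derivative g' x) (at x within S)" "\<And>v. Ck_on k (\<lambda>x. g' x v) S"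
    by auto
  then show ?case unfolding Ck_on.simps(2)
    by (intro exI[of _ "\<lambda>x v. A (g' x v)"])
       (auto intro!: bounded_linear.has_derivative[OF assms] Suc.IH)
qed

lemma Ck_on_scaleR:
  fixes c :: "'a::euclidean_space \<Rightarrow> real" and g :: "'a \<Rightarrow> 'b::euclidean_space"
  shows "Ck_on k c S \<Longrightarrow> Ck_on k g S \<Longrightarrow> Ck_on k (\<lambda>x. c x *\<^sub>R g x) S"
proof (induction k arbitrary: c g)
  case (Suc k)
  from Suc.prems obtain c' g' where *:
    "\<forall>x\<in>S. (c has_derivative c' x) (at x within S)" "\<And>v. Ck_on k (\<lambda>x. c' x v) S"
    "\<forall>x\<in>S. (g has_derivative g' x) (at x within S)" "\<And>v. Ck_on k (\<lambda>x. g' x v) S"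
    by auto
  have "Ck_on k (\<lambda>x. c x *\<^sub>R g' x v + c' x v *\<^sub>R g x) S" for v
    by (intro Ck_on_add Suc.IH *(2,4) Suc.prems[THEN Ck_on_Suc_imp])
  then show ?case unfolding Ck_on.simps(2)
    by (intro exI[of _ "\<lambda>x v. c x *\<^sub>R g' x v + c' x v *\<^sub>R g x"])
       (use * in \<open>auto intro!: has_derivative_scaleR\<close>)
qed (simp add: continuous_on_scaleR)

text \<open>
  \<open>Q\<close> is the derivative of \<open>P\<close> along every solution of \<open>u' = F(t, u)\<close> inside \<open>S\<close>, the total
  (or material) derivative. It is stated through solutions, since derivatives within an arbitrary set
  \<open>S\<close> are not unique.
\<close>
definition flow_deriv ::
  "(real \<times> 'a::euclidean_space \<Rightarrow> 'a) \<Rightarrow> (real \<times> 'a) set \<Rightarrow>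
   (real \<times> 'a \<Rightarrow> 'b::euclidean_space) \<Rightarrow> (real \<times> 'a \<Rightarrow> 'b) \<Rightarrow> bool" where
  "flow_deriv F S P Q \<longleftrightarrow> (\<forall>I u.
     (\<forall>t\<in>I. (t, u t) \<in> S \<and> (u has_vector_derivative F (t, u t)) (at t within I)) \<longrightarrow>
     (\<forall>t\<in>I. ((\<lambda>t. P (t, u t)) has_vector_derivative Q (t, u t)) (at t within I)))"

text \<open>
  By the chain rule the total derivative is \<open>P' (1, F)\<close>. The directional derivatives of \<open>P\<close> are
  known to be \<open>C^k\<close> for constant directions only, so the direction \<open>(1, F)\<close> is expanded in a basis; the
  coefficients are the components of \<open>F\<close>.
\<close>
lemma Ck_on_flow_deriv:
  fixes F :: "real \<times> 'a::euclidean_space \<Rightarrow> 'a" and P :: "real \<times> 'a \<Rightarrow> 'b::euclidean_space"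
  assumes "Ck_on k F S" and "Ck_on (Suc k) P S"
  shows "\<exists>Q. Ck_on k Q S \<and> flow_deriv F S P Q"
proof -
  from assms(2) obtain P' where P': "\<And>w. w \<in> S \<Longrightarrow> (P has_derivative P' w) (at w within S)"
    and Ck: "\<And>v. Ck_on k (\<lambda>w. P' w v) S"
    by auto
  define Q where "Q = (\<lambda>w. P' w (1, 0) + (\<Sum>b\<in>Basis. (F w \<bullet> b) *\<^sub>R P' w (0, b)))"
  have Q: "Q w = P' w (1, F w)" if "w \<in> S" for w
  proof -
    interpret bounded_linear "P' w" by (rule has_derivative_bounded_linear[OF P'[OF that]])
    have "(1, F w) = (1, 0) + (\<Sum>b\<in>Basis. (F w \<bullet> b) *\<^sub>R (0::real, b))"
      by (simp add: prod_eq_iff fst_sum snd_sum euclidean_representation)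
    then show ?thesis by (simp only: Q_def add sum scaleR)
  qed
  have "flow_deriv F S P Q"
    unfolding flow_deriv_def
  proof (intro allI impI ballI)
    fix I u t
    assume u: "\<forall>t\<in>I. (t, u t) \<in> S \<and> (u has_vector_derivative F (t, u t)) (at t within I)"
      and t: "t \<in> I"
    let ?w = "(t, u t)"
    have "((\<lambda>t. (t, u t)) has_derivative (\<lambda>h. (h, h *\<^sub>R F ?w))) (at t within I)"
      using u t unfolding has_vector_derivative_def
      by (auto intro!: has_derivative_Pair has_derivative_ident)
    moreover have "(P has_derivative P' ?w) (at ?w within (\<lambda>t. (t, u t)) ` I)"
      using u t by (intro has_derivative_subset[OF P']) auto
    ultimately have "((\<lambda>t. P (t, u t)) has_derivative (\<lambda>h. P' ?w (h, h *\<^sub>R F ?w))) (at t within I)"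
      by (rule has_derivative_in_compose)
    moreover have "P' ?w (h, h *\<^sub>R F ?w) = h *\<^sub>R Q ?w" for h
    proof -
      interpret bounded_linear "P' ?w"
        by (rule has_derivative_bounded_linear[OF P']) (use u t in auto)
      have "(h, h *\<^sub>R F ?w) = h *\<^sub>R (1, F ?w)" by simp
      then show ?thesis using Q[of ?w] u t by (simp only: scaleR)
    qed
    ultimately show "((\<lambda>t. P (t, u t)) has_vector_derivative Q ?w) (at t within I)"
      by (simp add: has_vector_derivative_def)
  qed
  moreover have "Ck_on k Q S"
    unfolding Q_def using assms(1)
    by (intro Ck_on_add Ck_on_sum Ck_on_scaleR Ck Ck_on_bounded_linear[OF bounded_linear_inner_left])
  ultimately show ?thesis by blast
qed

text \<open>
  Applied with \<open>P = F = f\<close>, this expresses \<open>u^(k+1)\<close> for every solution \<open>u\<close> through a single continuous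
  function \<open>\<Psi> k\<close> of \<open>(t, u(t))\<close>.
\<close>
lemma Ck_on_flow_derivs:
  fixes F :: "real \<times> 'a::euclidean_space \<Rightarrow> 'a" and P :: "real \<times> 'a \<Rightarrow> 'b::euclidean_space"
  shows "Ck_on n F S \<Longrightarrow> Ck_on n P S \<Longrightarrow>
    \<exists>\<Psi>. \<Psi> 0 = P \<and> (\<forall>k\<le>n. continuous_on S (\<Psi> k)) \<and> (\<forall>k<n. flow_deriv F S (\<Psi> k) (\<Psi> (Suc k)))"
proof (induction n arbitrary: P)
  case 0
  then show ?case by (intro exI[of _ "\<lambda>_. P"]) simp
next
  case (Suc n)
  obtain Q where Q: "Ck_on n Q S" "flow_deriv F S P Q"
    using Ck_on_flow_deriv[OF Ck_on_Suc_imp[OF Suc.prems(1)] Suc.prems(2)] by blast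
  obtain \<Psi> where \<Psi>: "\<Psi> 0 = Q" "\<forall>k\<le>n. continuous_on S (\<Psi> k)"
    "\<forall>k<n. flow_deriv F S (\<Psi> k) (\<Psi> (Suc k))"
    using Suc.IH[OF Ck_on_Suc_imp[OF Suc.prems(1)] Q(1)] by blast
  show ?case
  proof (intro exI[of _ "case_nat P \<Psi>"] conjI allI impI)
    fix k
    show "continuous_on S (case_nat P \<Psi> k)" if "k \<le> Suc n"
      using \<Psi> that Ck_on_imp_continuous_on[OF Suc.prems(2)] by (auto split: nat.split)
    show "flow_deriv F S (case_nat P \<Psi> k) (case_nat P \<Psi> (Suc k))" if "k < Suc n"
      using \<Psi> Q(2) that by (auto split: nat.split)
  qed simp
qed

section \<open>Interpolation and divided differences\<close>

text \<open>
  The bound by \<open>Max Z\<close> is what keeps the new zeros distinct when the induction adds a larger zero.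
\<close>
lemma rolle_zeros:
  fixes g g' :: "real \<Rightarrow> real"
  assumes der: "\<And>t. t \<in> {\<alpha>..\<beta>} \<Longrightarrow> (g has_real_derivative g' t) (at t within {\<alpha>..\<beta>})"
    and "finite Z" "Z \<noteq> {}" "Z \<subseteq> {\<alpha>..\<beta>}" "\<And>z. z \<in> Z \<Longrightarrow> g z = 0"
  shows "\<exists>Z'. finite Z' \<and> Suc (card Z') = card Z \<and> Z' \<subseteq> {\<alpha>..\<beta>} \<and> (\<forall>z\<in>Z'. z < Max Z \<and> g' z = 0)"
  using assms(2-)
proof (induction Z rule: finite_linorder_max_induct)
  case (insert b Z)
  show ?case
  proof (cases "Z = {}")
    case True
    then show ?thesis by (intro exI[of _ "{}"]) simp
  next
    case False
    define m where "m = Max Z"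
    have mZ: "m \<in> Z" using insert.hyps False Max_in[of Z] by (simp add: m_def)
    have m: "m \<in> Z" "m < b" "{m..b} \<subseteq> {\<alpha>..\<beta>}"
      using mZ insert.hyps insert.prems by auto
    obtain Z' where Z': "finite Z'" "Suc (card Z') = card Z" "Z' \<subseteq> {\<alpha>..\<beta>}"
      "\<forall>z\<in>Z'. z < m \<and> g' z = 0"
      using insert.IH[OF False] insert.prems unfolding m_def by auto
    have "(g has_derivative (\<lambda>h. g' x * h)) (at x within {m..b})" if "x \<in> {m..b}" for x
      using der[of x] that m(3) unfolding has_field_derivative_def
      by (blast intro: has_derivative_subset)
    then obtain \<theta> where \<theta>: "\<theta> \<in> {m<..<b}" "g b - g m = g' \<theta> * (b - m)"
      using mvt_simple[of m b g "\<lambda>x h. g' x * h"] m(2) by auto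
    have "g' \<theta> = 0"
      using \<theta> insert.prems m by simp
    moreover have "Max (insert b Z) = b"
      using insert.hyps by (intro Max_eqI) (auto intro: less_imp_le)
    moreover have "\<theta> \<notin> Z'" using Z'(4) \<theta>(1) by fastforce
    ultimately show ?thesis
      using Z' \<theta>(1) m insert.hyps by (intro exI[of _ "insert \<theta> Z'"]) force
  qed
qed simp

lemma iterated_rolle:
  fixes G :: "nat \<Rightarrow> real \<Rightarrow> real"
  assumes "\<And>k t. k < n \<Longrightarrow> t \<in> {\<alpha>..\<beta>} \<Longrightarrow> (G k has_real_derivative G (Suc k) t) (at t within {\<alpha>..\<beta>})"
    and "card Z = Suc n" "Z \<subseteq> {\<alpha>..\<beta>}" "\<And>z. z \<in> Z \<Longrightarrow> G 0 z = 0"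
  shows "\<exists>\<theta>\<in>{\<alpha>..\<beta>}. G n \<theta> = 0"
  using assms
proof (induction n arbitrary: G Z)
  case 0
  then obtain z where "Z = {z}" by (auto simp: card_Suc_eq)
  with 0 show ?case by auto
next
  case (Suc n)
  have fin: "finite Z" "Z \<noteq> {}" using Suc.prems(2) by (auto intro: card_ge_0_finite)
  obtain Z' where Z': "Suc (card Z') = card Z" "Z' \<subseteq> {\<alpha>..\<beta>}" "\<forall>z\<in>Z'. G 1 z = 0"
  proof -
    have "\<exists>Z'. finite Z' \<and> Suc (card Z') = card Z \<and> Z' \<subseteq> {\<alpha>..\<beta>} \<and> (\<forall>z\<in>Z'. z < Max Z \<and> G 1 z = 0)"
      by (rule rolle_zeros[of \<alpha> \<beta> "G 0"]) (use fin Suc.prems in auto)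
    with that show ?thesis by blast
  qed
  show ?case
    using Suc.IH[of "\<lambda>k. G (Suc k)" Z'] Suc.prems Z' by auto
qed

lemma poly_higher_pderiv_top:
  fixes P :: "real poly"
  assumes "degree P \<le> r"
  shows "poly ((pderiv ^^ r) P) t = fact r * coeff P r"
proof -
  have "(pderiv ^^ r) P = [:fact r * coeff P r:]"
  proof (rule poly_eqI)
    fix n
    show "coeff ((pderiv ^^ r) P) n = coeff [:fact r * coeff P r:] n"
      using assms
      by (cases n) (auto simp: coeff_higher_pderiv coeff_eq_0 pochhammer_fact[symmetric])
  qed
  then show ?thesis by simp
qed

text \<open>
  Rolle's theorem for \<open>G 0 - P\<close>: the \<open>r\<close>-th derivative of a polynomial of degree at most \<open>r\<close> is the
  constant \<open>r!\<close> times its leading coefficient. Both the mean value formula for divided differences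
  and the remainder of Lagrange interpolation are instances.
\<close>
lemma mean_value_interpolation:
  fixes G :: "nat \<Rightarrow> real \<Rightarrow> real"
  assumes der: "\<And>k t. k < r \<Longrightarrow> t \<in> {\<alpha>..\<beta>} \<Longrightarrow> (G k has_real_derivative G (Suc k) t) (at t within {\<alpha>..\<beta>})"
    and Z: "card Z = Suc r" "Z \<subseteq> {\<alpha>..\<beta>}"
    and P: "degree P \<le> r" "\<And>z. z \<in> Z \<Longrightarrow> poly P z = G 0 z"
  shows "\<exists>\<theta>\<in>{\<alpha>..\<beta>}. G r \<theta> = fact r * coeff P r"
proof -
  define D where "D = (\<lambda>k t. G k t - poly ((pderiv ^^ k) P) t)"
  have "\<exists>\<theta>\<in>{\<alpha>..\<beta>}. D r \<theta> = 0"
  proof (rule iterated_rolle[OF _ Z])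
    fix k t assume "k < r" "t \<in> {\<alpha>..\<beta>}"
    then show "(D k has_real_derivative D (Suc k) t) (at t within {\<alpha>..\<beta>})"
      unfolding D_def
      using DERIV_subset[OF poly_DERIV[of "(pderiv ^^ k) P" t] subset_UNIV]
      by (auto intro!: DERIV_diff der)
  qed (simp add: D_def P)
  then show ?thesis by (simp add: D_def poly_higher_pderiv_top[OF P(1)])
qed

text \<open>
  A divided difference is the leading coefficient of the interpolating polynomial.
\<close>
lemma divdiff_interpolation_poly:
  fixes g :: "real \<Rightarrow> real^'d"
  shows "inj_on t {i..i+k} \<Longrightarrow>
    \<exists>P. degree P \<le> k \<and> coeff P k = divdiff g t k i \<bullet> b \<and> (\<forall>j\<in>{i..i+k}. poly P (t j) = g (t j) \<bullet> b)"
proof (induction k arbitrary: i)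
  case 0
  show ?case by (intro exI[of _ "[:g (t i) \<bullet> b:]"]) simp
next
  case (Suc k)
  obtain A where A: "degree A \<le> k" "coeff A k = divdiff g t k i \<bullet> b"
    "\<And>j. j \<in> {i..i+k} \<Longrightarrow> poly A (t j) = g (t j) \<bullet> b"
    using Suc.IH[OF inj_on_subset[OF Suc.prems]] by force
  obtain B where B: "degree B \<le> k" "coeff B k = divdiff g t k (Suc i) \<bullet> b"
    "\<And>j. j \<in> {Suc i..Suc i+k} \<Longrightarrow> poly B (t j) = g (t j) \<bullet> b"
    using Suc.IH[of "Suc i", OF inj_on_subset[OF Suc.prems]] by force
  define d where "d = t (i + Suc k) - t i"
  have d: "d \<noteq> 0"
    using inj_onD[OF Suc.prems, of "i + Suc k" i] by (auto simp: d_def)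
  \<comment> \<open>Neville's recursion: the interpolants at the first and at the last \<open>k + 1\<close> nodes are
    blended so that their leading coefficients combine as in the definition of \<open>divdiff\<close>.\<close>
  define P where "P = smult (1 / d) ([:- t i, 1:] * B - [:- t (i + Suc k), 1:] * A)"
  have "degree ([:- x, 1:] * Q) \<le> Suc k" if "degree Q \<le> k" for x and Q :: "real poly"
    using degree_mult_le[of "[:- x, 1:]" Q] that by simp
  then have "degree P \<le> Suc k"
    unfolding P_def using A(1) B(1) by (intro order_trans[OF degree_smult_le] degree_diff_le) auto
  moreover have "coeff P (Suc k) = divdiff g t (Suc k) i \<bullet> b"
    using A(1,2) B(1,2) by (simp add: P_def d_def coeff_eq_0 inner_diff_left)
  moreover have "poly P (t j) = g (t j) \<bullet> b" if "j \<in> {i..i + Suc k}" for j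
  proof -
    have "j = i \<or> j = i + Suc k \<or> j \<in> {i..i+k} \<and> j \<in> {Suc i..Suc i+k}"
      using that by auto
    then consider "j = i" | "j = i + Suc k" | "j \<in> {i..i+k}" "j \<in> {Suc i..Suc i+k}"
      by blast
    then show ?thesis
    proof cases
      case 3
      then show ?thesis
        using A(3)[of j] B(3)[of j] d by (simp add: P_def field_simps d_def)
    qed (use A(3)[of i] B(3)[of "i + Suc k"] d in \<open>auto simp: P_def field_simps d_def\<close>)
  qed
  ultimately show ?case by blast
qed

lemma divdiff_mean_value:
  fixes g :: "real \<Rightarrow> real^'d"
  assumes der: "\<And>k t. k < r \<Longrightarrow> t \<in> {\<alpha>..\<beta>} \<Longrightarrow> (G k has_real_derivative G (Suc k) t) (at t within {\<alpha>..\<beta>})"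
    and G0: "\<And>t. t \<in> {\<alpha>..\<beta>} \<Longrightarrow> G 0 t = g t \<bullet> b"
    and s: "inj_on s {0..r}" "\<And>j. j \<le> r \<Longrightarrow> s j \<in> {\<alpha>..\<beta>}"
  shows "\<exists>\<theta>\<in>{\<alpha>..\<beta>}. G r \<theta> = fact r * (divdiff g s r 0 \<bullet> b)"
proof -
  obtain P where P: "degree P \<le> r" "coeff P r = divdiff g s r 0 \<bullet> b"
    "\<And>j. j \<in> {0..r} \<Longrightarrow> poly P (s j) = g (s j) \<bullet> b"
    using divdiff_interpolation_poly[of s 0 r g b] s(1) by auto
  have "\<exists>\<theta>\<in>{\<alpha>..\<beta>}. G r \<theta> = fact r * coeff P r"
    by (rule mean_value_interpolation[where Z = "s ` {0..r}"])
       (use der s G0 P in \<open>auto simp: card_image\<close>)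
  then show ?thesis by (simp add: P)
qed

lemma lagrange_interp_node:
  assumes "inj_on s {..<r}" "k < r"
  shows "lagrange_interp r s g (s k) = g (s k)"
proof -
  have "(\<Prod>j\<in>{..<r} - {l}. (s k - s j) / (s l - s j)) = (if l = k then 1 else 0)" if "l < r" for l
  proof (cases "l = k")
    case True
    have "(s k - s j) / (s k - s j) = 1" if "j \<in> {..<r} - {k}" for j
      using inj_onD[OF assms(1), of k j] assms(2) that by auto
    then show ?thesis using True by simp
  next
    case False
    then show ?thesis using assms(2) by (auto intro!: prod_zero bexI[of _ k])
  qed
  then have "lagrange_interp r s g (s k) = (\<Sum>l<r. (if l = k then 1 else 0) *\<^sub>R g (s l))"
    unfolding lagrange_interp_def by (intro sum.cong) auto
  also have "\<dots> = (\<Sum>l<r. if l = k then g (s l) else 0)"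
    by (intro sum.cong) auto
  finally show ?thesis using assms(2) by simp
qed

lemma lagrange_interp_poly:
  assumes "r \<ge> 1"
  shows "\<exists>Q. degree Q < r \<and> (\<forall>\<xi>. poly Q \<xi> = lagrange_interp r s g \<xi> \<bullet> b)"
proof -
  define W where "W = (\<lambda>k. \<Prod>j\<in>{..<r} - {k}. smult (1 / (s k - s j)) [:- s j, 1:])"
  define Q where "Q = (\<Sum>k<r. smult (g (s k) \<bullet> b) (W k))"
  have "degree (W k) \<le> r - 1" if "k < r" for k
  proof -
    have "degree (W k) \<le> (\<Sum>j\<in>{..<r} - {k}. degree (smult (1 / (s k - s j)) [:- s j, 1:]))"
      unfolding W_def
      using degree_prod_sum_le[of "{..<r} - {k}" "\<lambda>j. smult (1 / (s k - s j)) [:- s j, 1:]"]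
      by (simp add: comp_def)
    also have "\<dots> \<le> (\<Sum>j\<in>{..<r} - {k}. 1)"
      by (intro sum_mono) (auto intro: order_trans[OF degree_smult_le])
    finally show ?thesis using that by simp
  qed
  then have "degree Q \<le> r - 1"
    unfolding Q_def by (intro degree_sum_le) (auto intro: order_trans[OF degree_smult_le])
  moreover have "poly Q \<xi> = lagrange_interp r s g \<xi> \<bullet> b" for \<xi>
  proof -
    have "poly (W k) \<xi> = (\<Prod>j\<in>{..<r} - {k}. (\<xi> - s j) / (s k - s j))" for k
      unfolding W_def poly_prod by (intro prod.cong) (auto simp: diff_divide_distrib)
    then show ?thesis
      by (simp add: Q_def lagrange_interp_def poly_sum inner_sum_left mult.commute)
  qed
  ultimately show ?thesis using assms by (intro exI[of _ Q]) auto
qed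

lemma lagrange_remainder:
  fixes g :: "real \<Rightarrow> real^'d"
  assumes r: "r \<ge> 1"
    and der: "\<And>k t. k < r \<Longrightarrow> t \<in> {\<alpha>..\<beta>} \<Longrightarrow> (G k has_real_derivative G (Suc k) t) (at t within {\<alpha>..\<beta>})"
    and G0: "\<And>t. t \<in> {\<alpha>..\<beta>} \<Longrightarrow> G 0 t = g t \<bullet> b"
    and s: "inj_on s {..<r}" "\<And>j. j < r \<Longrightarrow> s j \<in> {\<alpha>..\<beta>}" and \<xi>: "\<xi> \<in> {\<alpha>..\<beta>}"
  shows "\<exists>\<theta>\<in>{\<alpha>..\<beta>}. (g \<xi> - lagrange_interp r s g \<xi>) \<bullet> b = G r \<theta> / fact r * (\<Prod>j<r. \<xi> - s j)"
proof (cases "\<xi> \<in> s ` {..<r}")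
  case True
  then obtain k where "k < r" "\<xi> = s k" by auto
  then have "(\<Prod>j<r. \<xi> - s j) = 0" "g \<xi> - lagrange_interp r s g \<xi> = 0"
    using lagrange_interp_node[OF s(1), of k g] by (auto intro!: prod_zero)
  then show ?thesis using \<xi> by auto
next
  case False
  obtain Q where Q: "degree Q < r" "\<And>\<xi>. poly Q \<xi> = lagrange_interp r s g \<xi> \<bullet> b"
    using lagrange_interp_poly[OF r] by blast
  define W where "W = (\<Prod>j<r. [:- s j, 1:])"
  have W: "poly W x = (\<Prod>j<r. x - s j)" for x
    unfolding W_def poly_prod by (intro prod.cong) auto
  have "degree W = r"
    unfolding W_def by (subst degree_prod_eq_sum_degree) auto
  moreover have "lead_coeff W = 1"
    unfolding W_def lead_coeff_prod by simp
  ultimately have Wr: "degree W = r" "coeff W r = 1" by auto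
  have W\<xi>: "poly W \<xi> \<noteq> 0" using False by (auto simp: W)
  \<comment> \<open>The multiple of the nodal polynomial that makes the interpolant also match \<open>g\<close> at \<open>\<xi>\<close>.\<close>
  define c where "c = (g \<xi> - lagrange_interp r s g \<xi>) \<bullet> b / poly W \<xi>"
  define P where "P = Q + smult c W"
  have P: "degree P \<le> r" "coeff P r = c"
    using Q(1) Wr by (auto simp: P_def coeff_eq_0 intro!: degree_add_le)
  have "poly P z = G 0 z" if z: "z \<in> insert \<xi> (s ` {..<r})" for z
  proof (cases "z = \<xi>")
    case True
    then show ?thesis using W\<xi> G0 \<xi> by (simp add: P_def Q(2) c_def inner_diff_left)
  next
    case False
    then obtain k where k: "k < r" "z = s k" using z by auto
    then have "poly W z = 0" by (auto simp: W)
    then show ?thesis using k s G0 by (simp add: P_def Q(2) lagrange_interp_node)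
  qed
  then have "\<exists>\<theta>\<in>{\<alpha>..\<beta>}. G r \<theta> = fact r * coeff P r"
    using False s \<xi> P(1)
    by (intro mean_value_interpolation[where Z = "insert \<xi> (s ` {..<r})"] der)
       (auto simp: card_image)
  then obtain \<theta> where "\<theta> \<in> {\<alpha>..\<beta>}" "G r \<theta> = fact r * c" using P by auto
  then show ?thesis using W\<xi> by (intro bexI[of _ \<theta>]) (simp_all add: c_def W)
qed

text \<open>
  Each order of differencing divides a difference of two values by a gap of length at least \<open>d\<close>.
\<close>
lemma divdiff_diff_le:
  fixes g1 g2 :: "real \<Rightarrow> real^'d"
  assumes "d > 0"
  shows "(\<And>j. j \<in> {i..i+k} \<Longrightarrow> infnorm (g1 (t j) - g2 (t j)) \<le> e) \<Longrightarrow>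
    (\<And>j l. i \<le> j \<Longrightarrow> j < l \<Longrightarrow> l \<le> i + k \<Longrightarrow> d \<le> t l - t j) \<Longrightarrow>
    infnorm (divdiff g1 t k i - divdiff g2 t k i) \<le> (2 / d) ^ k * e"
proof (induction k arbitrary: i)
  case (Suc k)
  define D where "D = (\<lambda>i. divdiff g1 t k i - divdiff g2 t k i)"
  have D1: "infnorm (D i) \<le> (2 / d) ^ k * e"
    unfolding D_def by (rule Suc.IH) (use Suc.prems in auto)
  have D2: "infnorm (D (Suc i)) \<le> (2 / d) ^ k * e"
    unfolding D_def by (rule Suc.IH) (use Suc.prems in auto)
  have sp: "d \<le> t (i + Suc k) - t i" using Suc.prems(2)[of i "i + Suc k"] by auto
  have "divdiff g1 t (Suc k) i - divdiff g2 t (Suc k) i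
      = (1 / (t (i + Suc k) - t i)) *\<^sub>R (D (Suc i) - D i)"
    by (simp add: D_def algebra_simps)
  then have "infnorm (divdiff g1 t (Suc k) i - divdiff g2 t (Suc k) i)
      = 1 / (t (i + Suc k) - t i) * infnorm (D (Suc i) - D i)"
    using sp assms by (simp add: infnorm_mul)
  also have "infnorm (D (Suc i) - D i) \<le> infnorm (D (Suc i)) + infnorm (D i)"
    using infnorm_triangle[of "D (Suc i)" "- D i"] by (simp add: infnorm_neg)
  also have "\<dots> \<le> 2 * ((2 / d) ^ k * e)" using D1 D2 by simp
  also have "1 / (t (i + Suc k) - t i) * (2 * ((2 / d) ^ k * e)) \<le> 1 / d * (2 * ((2 / d) ^ k * e))"
    using sp assms D1 infnorm_pos_le[of "D i"]
    by (intro mult_right_mono frac_le) (auto simp del: zero_le_mult_iff intro!: mult_nonneg_nonneg)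
  finally show ?case
    using sp assms by (simp add: mult_left_mono divide_right_mono mult_ac)
qed auto

text \<open>
  Every factor \<open>(\<xi> - s j) / (s k - s j)\<close> is at most \<open>r\<close>, which gives a crude Lebesgue constant
  independent of the interval.
\<close>
lemma lagrange_interp_diff_le:
  fixes g1 g2 :: "real \<Rightarrow> real^'d"
  assumes e: "\<And>k. k < r \<Longrightarrow> infnorm (g1 (s k) - g2 (s k)) \<le> e"
    and \<sigma>\<tau>: "\<sigma> < \<tau>" and s: "\<And>j. j < r \<Longrightarrow> s j \<in> {\<sigma>..\<tau>}"
    and sep: "\<And>j k. j < r \<Longrightarrow> k < r \<Longrightarrow> j \<noteq> k \<Longrightarrow> (\<tau> - \<sigma>) / real r \<le> \<bar>s j - s k\<bar>"
    and \<xi>: "\<xi> \<in> {\<sigma>..\<tau>}"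
  shows "infnorm (lagrange_interp r s g1 \<xi> - lagrange_interp r s g2 \<xi>) \<le> real r * real r ^ r * e"
proof -
  define w where "w = (\<lambda>k. \<Prod>j\<in>{..<r} - {k}. (\<xi> - s j) / (s k - s j))"
  have w: "\<bar>w k\<bar> \<le> real r ^ r" if "k < r" for k
  proof -
    have "\<bar>w k\<bar> \<le> (\<Prod>j\<in>{..<r} - {k}. real r)"
      unfolding w_def abs_prod
    proof (intro prod_mono conjI)
      fix j assume j: "j \<in> {..<r} - {k}"
      then have sp: "(\<tau> - \<sigma>) / real r \<le> \<bar>s k - s j\<bar>" "0 < (\<tau> - \<sigma>) / real r"
        using sep[of k j] that \<sigma>\<tau> by auto
      have "\<bar>\<xi> - s j\<bar> \<le> \<tau> - \<sigma>" using \<xi> s[of j] j by auto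
      then have "\<bar>\<xi> - s j\<bar> / \<bar>s k - s j\<bar> \<le> (\<tau> - \<sigma>) / ((\<tau> - \<sigma>) / real r)"
        using sp \<sigma>\<tau> by (intro frac_le) auto
      also have "\<dots> = real r" using \<sigma>\<tau> by simp
      finally show "\<bar>(\<xi> - s j) / (s k - s j)\<bar> \<le> real r" by (simp add: abs_divide)
    qed simp
    also have "\<dots> = real r ^ (r - 1)" using that by simp
    also have "\<dots> \<le> real r ^ r" using that by (intro power_increasing) auto
    finally show ?thesis .
  qed
  have "infnorm (\<Sum>k<r. w k *\<^sub>R (g1 (s k) - g2 (s k))) \<le> (\<Sum>k<r. real r ^ r * e)"
  proof (rule infnorm_sum_le)
    fix k assume "k \<in> {..<r}"
    then show "infnorm (w k *\<^sub>R (g1 (s k) - g2 (s k))) \<le> real r ^ r * e"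
      unfolding infnorm_mul using w[of k] e[of k] infnorm_pos_le[of "g1 (s k) - g2 (s k)"]
      by (intro mult_mono) auto
  qed
  moreover have "lagrange_interp r s g1 \<xi> - lagrange_interp r s g2 \<xi>
      = (\<Sum>k<r. w k *\<^sub>R (g1 (s k) - g2 (s k)))"
    by (simp add: lagrange_interp_def w_def sum_subtractf scaleR_diff_right)
  ultimately show ?thesis by (simp add: mult.assoc)
qed

lemma continuous_on_lagrange_interp: "continuous_on T (lagrange_interp r s g)"
  unfolding lagrange_interp_def divide_inverse by (intro continuous_intros)

section \<open>Well spaced nodes\<close>

text \<open>
  The common properties of the trial nodes (\<open>n = r + 1\<close>) and of the nodes of the accepted step
  (\<open>n = r\<close>): they lie in the interval, in increasing order, with gaps of at least \<open>(\<tau> - \<sigma>) / r\<close>.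
\<close>
definition well_spaced :: "nat \<Rightarrow> nat \<Rightarrow> real \<Rightarrow> real \<Rightarrow> (nat \<Rightarrow> real) \<Rightarrow> bool" where
  "well_spaced n r \<sigma> \<tau> s \<longleftrightarrow>
     (\<forall>j<n. s j \<in> {\<sigma>..\<tau>}) \<and> (\<forall>k<n. \<forall>j<k. (\<tau> - \<sigma>) / real r \<le> s k - s j)"

lemma well_spaced_mono: "well_spaced n r \<sigma> \<tau> s \<Longrightarrow> m \<le> n \<Longrightarrow> well_spaced m r \<sigma> \<tau> s"
  by (simp add: well_spaced_def)

lemma well_spaced_sep:
  assumes "well_spaced n r \<sigma> \<tau> s" "j < n" "k < n" "j \<noteq> k"
  shows "(\<tau> - \<sigma>) / real r \<le> \<bar>s j - s k\<bar>"
proof (cases "j < k")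
  case True
  then have "(\<tau> - \<sigma>) / real r \<le> s k - s j" using assms unfolding well_spaced_def by blast
  then show ?thesis by linarith
next
  case False
  then have "k < j" using assms by simp
  then have "(\<tau> - \<sigma>) / real r \<le> s j - s k" using assms unfolding well_spaced_def by blast
  then show ?thesis by linarith
qed

lemma well_spaced_inj:
  assumes "well_spaced n r \<sigma> \<tau> s" "\<sigma> < \<tau>" "r \<ge> 1"
  shows "inj_on s {..<n}"
proof (rule inj_onI, rule ccontr)
  fix j k assume "j \<in> {..<n}" "k \<in> {..<n}" "s j = s k" "j \<noteq> k"
  then show False
    using well_spaced_sep[OF assms(1), of j k] assms(2,3) by (simp add: divide_le_0_iff)
qed

lemma well_spaced_trial_node:
  assumes "\<sigma> < \<tau>" "r \<ge> 1"
  shows "well_spaced (Suc r) r \<sigma> \<tau> (trial_node r \<sigma> \<tau>)"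
  unfolding well_spaced_def
proof (intro conjI allI impI)
  fix j assume "j < Suc r"
  then have "real j * (\<tau> - \<sigma>) \<le> real r * (\<tau> - \<sigma>)"
    using assms by (intro mult_right_mono) auto
  then have "real j * (\<tau> - \<sigma>) / real r \<le> \<tau> - \<sigma>"
    using assms by (simp add: divide_le_eq mult.commute)
  then show "trial_node r \<sigma> \<tau> j \<in> {\<sigma>..\<tau>}"
    using assms by (simp add: trial_node_def)
next
  fix k j :: nat assume jk: "j < k"
  have "1 * (\<tau> - \<sigma>) \<le> (real k - real j) * (\<tau> - \<sigma>)"
    using jk assms by (intro mult_right_mono) auto
  then have "(\<tau> - \<sigma>) / real r \<le> (real k - real j) * (\<tau> - \<sigma>) / real r"
    by (intro divide_right_mono) auto
  then show "(\<tau> - \<sigma>) / real r \<le> trial_node r \<sigma> \<tau> k - trial_node r \<sigma> \<tau> j"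
    by (simp add: trial_node_def left_diff_distrib diff_divide_distrib)
qed

lemma well_spaced_node:
  assumes "\<sigma> < \<tau>" "r \<ge> 1"
  shows "well_spaced r r \<sigma> \<tau> (node r \<sigma> \<tau>)"
proof (cases "r = 1")
  case True
  then show ?thesis using assms by (simp add: well_spaced_def node_def)
next
  case False
  then have "well_spaced (Suc (r - 1)) (r - 1) \<sigma> \<tau> (trial_node (r - 1) \<sigma> \<tau>)"
    using assms by (intro well_spaced_trial_node) auto
  moreover have "node r \<sigma> \<tau> = trial_node (r - 1) \<sigma> \<tau>"
    using False by (simp add: node_def trial_node_def fun_eq_iff)
  moreover have "(\<tau> - \<sigma>) / real r \<le> (\<tau> - \<sigma>) / real (r - 1)"
    using assms False by (intro divide_left_mono) auto
  ultimately show ?thesis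
    using assms by (auto simp: well_spaced_def intro: order_trans)
qed

text \<open>
  The nodal polynomial is bounded by \<open>(\<tau> - \<sigma>) ^ r\<close>. No Lebesgue constant enters here, which
  matters because \<open>A\<close> becomes the leading constant of the local error.
\<close>
lemma lagrange_remainder_le:
  fixes G :: "nat \<Rightarrow> real \<Rightarrow> real^'d"
  assumes r: "r \<ge> 1" and \<sigma>\<tau>: "\<sigma> < \<tau>"
    and der: "\<And>k t. k < r \<Longrightarrow> t \<in> {\<sigma>..\<tau>} \<Longrightarrow> (G k has_vector_derivative G (Suc k) t) (at t within {\<sigma>..\<tau>})"
    and A: "\<And>t. t \<in> {\<sigma>..\<tau>} \<Longrightarrow> infnorm (G r t) \<le> fact r * A"
    and s: "well_spaced r r \<sigma> \<tau> s" and \<xi>: "\<xi> \<in> {\<sigma>..\<tau>}"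
  shows "infnorm (G 0 \<xi> - lagrange_interp r s (G 0) \<xi>) \<le> A * (\<tau> - \<sigma>) ^ r"
  unfolding infnorm_le_iff
proof
  fix b :: "real^'d" assume b: "b \<in> Basis"
  have sj: "s j \<in> {\<sigma>..\<tau>}" if "j < r" for j
    using s that by (simp add: well_spaced_def)
  obtain \<theta> where \<theta>: "\<theta> \<in> {\<sigma>..\<tau>}"
    "(G 0 \<xi> - lagrange_interp r s (G 0) \<xi>) \<bullet> b = (G r \<theta> \<bullet> b) / fact r * (\<Prod>j<r. \<xi> - s j)"
    using lagrange_remainder[of r \<sigma> \<tau> "\<lambda>k t. G k t \<bullet> b" "G 0" b s \<xi>] r \<xi>
      has_real_derivative_inner_component[OF der] well_spaced_inj[OF s \<sigma>\<tau> r] sj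
    by blast
  have "\<bar>\<Prod>j<r. \<xi> - s j\<bar> \<le> (\<Prod>j<r. \<tau> - \<sigma>)"
    unfolding abs_prod
  proof (intro prod_mono conjI)
    fix j assume "j \<in> {..<r}"
    then show "\<bar>\<xi> - s j\<bar> \<le> \<tau> - \<sigma>" using sj[of j] \<xi> by (auto simp: abs_le_iff)
  qed simp
  moreover have "\<bar>G r \<theta> \<bullet> b\<bar> \<le> fact r * A"
    using A[OF \<theta>(1)] b by (simp add: infnorm_le_iff)
  then have le: "\<bar>(G r \<theta> \<bullet> b) / fact r\<bar> \<le> A"
    by (simp add: abs_divide divide_le_eq mult.commute)
  moreover have "0 \<le> A" using order_trans[OF abs_ge_zero le] .
  ultimately show "\<bar>(G 0 \<xi> - lagrange_interp r s (G 0) \<xi>) \<bullet> b\<bar> \<le> A * (\<tau> - \<sigma>) ^ r"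
    unfolding \<theta>(2) abs_mult by (intro mult_mono) auto
qed

lemma divdiff_derivative:
  fixes G :: "nat \<Rightarrow> real \<Rightarrow> real^'d"
  assumes r: "r \<ge> 1" and \<sigma>\<tau>: "\<sigma> < \<tau>"
    and der: "\<And>k t. k < r \<Longrightarrow> t \<in> {\<sigma>..\<tau>} \<Longrightarrow> (G k has_vector_derivative G (Suc k) t) (at t within {\<sigma>..\<tau>})"
    and s: "well_spaced (Suc r) r \<sigma> \<tau> s"
    and b: "b \<in> Basis"
  shows "\<exists>\<theta>\<in>{\<sigma>..\<tau>}. G r \<theta> \<bullet> b = fact r * (divdiff (G 0) s r 0 \<bullet> b)"
proof (rule divdiff_mean_value[where G = "\<lambda>k t. G k t \<bullet> b"])
  have "{0..r} = {..<Suc r}" by auto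
  then show "inj_on s {0..r}" using well_spaced_inj[OF s \<sigma>\<tau> r] by simp
qed (use s has_real_derivative_inner_component[OF der] in \<open>auto simp: well_spaced_def\<close>)

section \<open>Error of the basic iteration\<close>

text \<open>
  One sweep multiplies the previous error by \<open>O(\<tau> - \<sigma>)\<close> and adds the integrated interpolation error
  of \<open>u' = f(t, u)\<close>. Comparing with the interpolant of \<open>u'\<close> means that only the values of the
  iterate at the nodes are needed, never its derivatives.
\<close>
lemma iterate_step_error:
  fixes f :: "real \<Rightarrow> real^'d \<Rightarrow> real^'d"
  assumes \<sigma>\<tau>: "\<sigma> < \<tau>"
    and lip: "\<And>t y y'. t \<in> {\<sigma>..\<tau>} \<Longrightarrow> infnorm (f t y - f t y') \<le> L * infnorm (y - y')" and L: "L \<ge> 0"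
    and u: "solves_ivp f \<sigma> \<tau> y u"
    and s: "well_spaced r r \<sigma> \<tau> s"
    and R: "\<And>t. t \<in> {\<sigma>..\<tau>} \<Longrightarrow> infnorm (f t (u t) - lagrange_interp r s (\<lambda>\<xi>. f \<xi> (u \<xi>)) t) \<le> R"
    and E: "\<And>t. t \<in> {\<sigma>..\<tau>} \<Longrightarrow> infnorm (iterate f r s \<sigma> y j t - u t) \<le> E"
    and t: "t \<in> {\<sigma>..\<tau>}"
  shows "infnorm (iterate f r s \<sigma> y (Suc j) t - u t) \<le> (real r * real r ^ r * L * E + R) * (\<tau> - \<sigma>)"
proof -
  define q where "q = (\<lambda>\<xi>. lagrange_interp r s (\<lambda>\<xi>. f \<xi> (iterate f r s \<sigma> y j \<xi>)) \<xi>)"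
  define v where "v = (\<lambda>t. iterate f r s \<sigma> y (Suc j) t - u t)"
  have "(v has_vector_derivative (0 + q x) - f x (u x)) (at x within {\<sigma>..\<tau>})" if "x \<in> {\<sigma>..\<tau>}" for x
    unfolding v_def iterate.simps q_def
    by (intro has_vector_derivative_diff has_vector_derivative_add has_vector_derivative_const
        integral_has_vector_derivative continuous_on_lagrange_interp that)
      (use u that in \<open>simp add: solves_ivp_def\<close>)
  moreover have "infnorm ((0 + q x) - f x (u x)) \<le> real r * real r ^ r * L * E + R"
    if x: "x \<in> {\<sigma>..\<tau>}" for x
  proof -
    have "infnorm (q x - lagrange_interp r s (\<lambda>\<xi>. f \<xi> (u \<xi>)) x) \<le> real r * real r ^ r * (L * E)"
      unfolding q_def
    proof (rule lagrange_interp_diff_le[OF _ \<sigma>\<tau>])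
      fix k assume "k < r"
      then have k: "s k \<in> {\<sigma>..\<tau>}" using s by (simp add: well_spaced_def)
      show "infnorm (f (s k) (iterate f r s \<sigma> y j (s k)) - f (s k) (u (s k))) \<le> L * E"
        using lip[OF k] E[OF k] L by (meson mult_left_mono order_trans)
    qed (use s x well_spaced_sep in \<open>auto simp: well_spaced_def\<close>)
    then show ?thesis
      using infnorm_triangle_sub[of "q x" "f x (u x)" "lagrange_interp r s (\<lambda>\<xi>. f \<xi> (u \<xi>)) x"] R[OF x]
      by (simp add: infnorm_sub mult.assoc)
  qed
  ultimately have "infnorm (v t - v \<sigma>) \<le> (real r * real r ^ r * L * E + R) * (t - \<sigma>)"
    using t by (rule infnorm_increment_le)
  also have "\<dots> \<le> (real r * real r ^ r * L * E + R) * (\<tau> - \<sigma>)"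
  proof (rule mult_left_mono)
    have "0 \<le> E" using E[OF t] infnorm_pos_le order_trans by blast
    moreover have "0 \<le> R" using R[OF t] infnorm_pos_le order_trans by blast
    ultimately show "0 \<le> real r * real r ^ r * L * E + R" using L by simp
  qed (use t in simp)
  also have "v \<sigma> = 0"
    using u by (simp add: v_def solves_ivp_def)
  finally show ?thesis by (simp only: v_def diff_zero)
qed

text \<open>
  The start \<open>l = y\<close> has error \<open>M (\<tau> - \<sigma>)\<close>, and each sweep gains one power of \<open>\<tau> - \<sigma>\<close>
  until the interpolation error of order \<open>r + 1\<close> is reached.
\<close>
lemma iterate_error:
  fixes f :: "real \<Rightarrow> real^'d \<Rightarrow> real^'d"
  assumes \<sigma>\<tau>: "\<sigma> < \<tau>" "\<tau> - \<sigma> \<le> 1"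
    and lip: "\<And>t y y'. t \<in> {\<sigma>..\<tau>} \<Longrightarrow> infnorm (f t y - f t y') \<le> L * infnorm (y - y')" and L: "L \<ge> 0"
    and u: "solves_ivp f \<sigma> \<tau> y u"
    and s: "well_spaced r r \<sigma> \<tau> s"
    and R: "\<And>t. t \<in> {\<sigma>..\<tau>} \<Longrightarrow>
      infnorm (f t (u t) - lagrange_interp r s (\<lambda>\<xi>. f \<xi> (u \<xi>)) t) \<le> M * (\<tau> - \<sigma>) ^ r"
    and M: "\<And>t. t \<in> {\<sigma>..\<tau>} \<Longrightarrow> infnorm (f t (u t)) \<le> M"
    and q: "q = real r * real r ^ r * L"
  shows "j \<le> r \<Longrightarrow> t \<in> {\<sigma>..\<tau>} \<Longrightarrow>
    infnorm (iterate f r s \<sigma> y j t - u t) \<le> M * (q + 1) ^ j * (\<tau> - \<sigma>) ^ Suc j"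
proof (induction j arbitrary: t)
  case 0
  have "infnorm (u t - u \<sigma>) \<le> M * (t - \<sigma>)"
    by (rule infnorm_increment_le[OF _ M]) (use u 0 in \<open>auto simp: solves_ivp_def\<close>)
  moreover have "0 \<le> M" using M[OF 0(2)] infnorm_pos_le order_trans by blast
  then have "M * (t - \<sigma>) \<le> M * (\<tau> - \<sigma>)" using 0 by (intro mult_left_mono) auto
  ultimately show ?case using u by (simp add: infnorm_sub solves_ivp_def)
next
  case (Suc j)
  define h where "h = \<tau> - \<sigma>"
  have h: "0 < h" "h \<le> 1" using \<sigma>\<tau> by (simp_all add: h_def)
  have M0: "0 \<le> M" using M[OF Suc.prems(2)] infnorm_pos_le order_trans by blast
  have q0: "q \<ge> 0" using L by (simp add: q)
  have "infnorm (iterate f r s \<sigma> y (Suc j) t - u t)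
      \<le> (real r * real r ^ r * L * (M * (q + 1) ^ j * h ^ Suc j) + M * h ^ r) * h"
    unfolding h_def
    by (rule iterate_step_error[OF \<sigma>\<tau>(1) lip L u s R]) (use Suc in auto)
  also have "\<dots> \<le> (q * (M * (q + 1) ^ j * h ^ Suc j) + M * (q + 1) ^ j * h ^ Suc j) * h"
  proof (rule mult_right_mono)
    have "h ^ r \<le> h ^ Suc j" using Suc.prems h by (intro power_decreasing) auto
    moreover have "1 \<le> (q + 1) ^ j" using q0 by (intro one_le_power) simp
    ultimately have "1 * h ^ r \<le> (q + 1) ^ j * h ^ Suc j"
      using h by (intro mult_mono) auto
    then have "M * h ^ r \<le> M * (q + 1) ^ j * h ^ Suc j"
      using M0 mult_left_mono by fastforce
    then show "real r * real r ^ r * L * (M * (q + 1) ^ j * h ^ Suc j) + M * h ^ r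
        \<le> q * (M * (q + 1) ^ j * h ^ Suc j) + M * (q + 1) ^ j * h ^ Suc j"
      by (simp add: q)
  qed (use h in simp)
  also have "\<dots> = M * (q + 1) ^ Suc j * h ^ Suc (Suc j)"
    by (simp add: algebra_simps)
  finally show ?case by (simp only: h_def)
qed

text \<open>
  The extra sweep \<open>r + 1\<close> pushes the propagated error to order \<open>r + 2\<close>, so that the constant of
  order \<open>r + 1\<close> is the interpolation constant \<open>A\<close> alone. The uniform bound \<open>M\<close> serves for the
  earlier sweeps, while \<open>A\<close> may be adapted to the step.
\<close>
lemma basic_iteration_error:
  fixes f :: "real \<Rightarrow> real^'d \<Rightarrow> real^'d"
  assumes \<sigma>\<tau>: "\<sigma> < \<tau>" "\<tau> - \<sigma> \<le> 1"
    and lip: "\<And>t y y'. t \<in> {\<sigma>..\<tau>} \<Longrightarrow> infnorm (f t y - f t y') \<le> L * infnorm (y - y')" and L: "L \<ge> 0"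
    and u: "solves_ivp f \<sigma> \<tau> y u"
    and s: "well_spaced r r \<sigma> \<tau> s"
    and R: "\<And>t. t \<in> {\<sigma>..\<tau>} \<Longrightarrow>
      infnorm (f t (u t) - lagrange_interp r s (\<lambda>\<xi>. f \<xi> (u \<xi>)) t) \<le> A * (\<tau> - \<sigma>) ^ r"
    and M: "\<And>t. t \<in> {\<sigma>..\<tau>} \<Longrightarrow> infnorm (f t (u t)) \<le> M" and AM: "A \<le> M"
    and q: "q = real r * real r ^ r * L"
    and t: "t \<in> {\<sigma>..\<tau>}"
  shows "infnorm (basic_iteration f r s \<sigma> y t - u t)
    \<le> (A + q * M * (q + 1) ^ r * (\<tau> - \<sigma>)) * (\<tau> - \<sigma>) ^ Suc r"
proof -
  define h where "h = \<tau> - \<sigma>"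
  have "A * h ^ r \<le> M * h ^ r" using AM \<sigma>\<tau> by (intro mult_right_mono) (auto simp: h_def)
  then have R': "infnorm (f t (u t) - lagrange_interp r s (\<lambda>\<xi>. f \<xi> (u \<xi>)) t) \<le> M * (\<tau> - \<sigma>) ^ r"
    if "t \<in> {\<sigma>..\<tau>}" for t
    using R[OF that] by (simp add: h_def)
  have "infnorm (iterate f r s \<sigma> y (Suc r) t - u t)
      \<le> (real r * real r ^ r * L * (M * (q + 1) ^ r * h ^ Suc r) + A * h ^ r) * h"
    unfolding h_def
    by (rule iterate_step_error[OF \<sigma>\<tau>(1) lip L u s R iterate_error[OF \<sigma>\<tau> lip L u s R' M q]])
       (use t in auto)
  also have "\<dots> = (A + q * M * (q + 1) ^ r * h) * h ^ Suc r"
    by (simp add: q algebra_simps)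
  finally show ?thesis by (simp add: basic_iteration_def h_def)
qed

section \<open>Uniformly smooth local solutions\<close>

text \<open>
  \<open>G k\<close> is the derivative of order \<open>k + 1\<close> of the solution \<open>u\<close>; \<open>M\<close> is meant to be independent of
  the initial point, and \<open>\<omega>\<close> bounds the oscillation of \<open>G r\<close> on the interval.
\<close>
definition smooth_solution ::
  "(real \<Rightarrow> real^'d \<Rightarrow> real^'d) \<Rightarrow> nat \<Rightarrow> real \<Rightarrow> real \<Rightarrow> real \<Rightarrow> real \<Rightarrow> real^'d \<Rightarrow>
   (real \<Rightarrow> real^'d) \<Rightarrow> (nat \<Rightarrow> real \<Rightarrow> real^'d) \<Rightarrow> bool" where
  "smooth_solution f r M \<omega> x e y u G \<longleftrightarrow>
     solves_ivp f x e y u \<and> (\<forall>t\<in>{x..e}. G 0 t = f t (u t)) \<and>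
     (\<forall>k<r. \<forall>t\<in>{x..e}. (G k has_vector_derivative G (Suc k) t) (at t within {x..e})) \<and>
     (\<forall>t\<in>{x..e}. infnorm (G 0 t) \<le> M \<and> infnorm (G r t) \<le> M) \<and>
     (\<forall>s\<in>{x..e}. \<forall>t\<in>{x..e}. infnorm (G r s - G r t) \<le> \<omega>)"

lemma smooth_solution_restrict:
  assumes "smooth_solution f r M \<omega> x e y u G" "e' \<le> e"
  shows "smooth_solution f r M \<omega> x e' y u G"
proof -
  have sub: "{x..e'} \<subseteq> {x..e}" using assms(2) by auto
  show ?thesis
    using assms(1) sub unfolding smooth_solution_def solves_ivp_def
    by (meson has_vector_derivative_within_subset subsetD)
qed

lemma compact_imp_infnorm_bounded:
  fixes g :: "'a::topological_space \<Rightarrow> 'b::euclidean_space"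
  assumes "compact S" "continuous_on S g"
  shows "\<exists>B. \<forall>w\<in>S. infnorm (g w) \<le> B"
proof -
  obtain B where "\<And>v. v \<in> g ` S \<Longrightarrow> norm v \<le> B"
    using compact_imp_bounded[OF compact_continuous_image[OF assms(2,1)]] by (auto simp: bounded_iff)
  then show ?thesis
    by (intro exI[of _ B]) (auto intro: order_trans[OF infnorm_le_norm])
qed

lemma eventually_small_mult: "d > 0 \<Longrightarrow> \<forall>\<^sub>F \<delta>::real in at_right 0. c * \<delta> \<le> d"
proof -
  assume "d > 0"
  have "((\<lambda>\<delta>. c * \<delta>) \<longlongrightarrow> c * 0) (at_right 0)" by (intro tendsto_intros)
  then have "\<forall>\<^sub>F \<delta> in at_right 0. c * \<delta> < d"
    using order_tendstoD(2)[of _ "c * 0" _ d] \<open>d > 0\<close> by auto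
  then show ?thesis by eventually_elim simp
qed

text \<open>
  The domain of smoothness of \<open>f\<close> extends by \<open>1\<close> beyond the global solution \<open>z\<close>. A local solution that
  starts within \<open>1/2\<close> of \<open>z\<close> moves by at most \<open>2 M \<delta> \<le> 1/2\<close>, so it stays there. Boundedness and
  uniform continuity of the functions \<open>\<Psi> k\<close> on this compact domain give the uniform constants.
\<close>
lemma class_F_smooth_local_solutions:
  fixes f :: "real \<Rightarrow> real^'d \<Rightarrow> real^'d"
  assumes ab: "a < b" and f: "f \<in> class_F a b \<eta> r"
  obtains L M z where "L \<ge> 0" "M > 0" "solves_ivp f a b \<eta> z"
    "\<And>t y y'. t \<in> {a..b} \<Longrightarrow> infnorm (f t y - f t y') \<le> L * infnorm (y - y')"
    "\<And>\<omega>. \<omega> > 0 \<Longrightarrow> \<forall>\<^sub>F \<delta> in at_right 0. \<forall>x\<in>{a..<b}. \<forall>y. infnorm (y - z x) \<le> 1 / 2 \<longrightarrow>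
       (\<exists>u G. smooth_solution f r M \<omega> x (min (x + \<delta>) b) y u G)"
proof -
  from f obtain L z where
    cont: "continuous_on ({a..b} \<times> UNIV) (\<lambda>(t, y). f t y)"
    and L: "L \<ge> 0" and lip: "\<And>t y y'. t \<in> {a..b} \<Longrightarrow> infnorm (f t y - f t y') \<le> L * infnorm (y - y')"
    and z: "solves_ivp f a b \<eta> z"
    and Ck: "Ck_on r (\<lambda>(t, y). f t y) ({a..b} \<times> {y. infnorm y \<le> (SUP t\<in>{a..b}. infnorm (z t)) + 1})"
    unfolding class_F_def by blast
  define F where "F = (\<lambda>(t, y). f t y)"
  define R where "R = (SUP t\<in>{a..b}. infnorm (z t)) + 1"
  define S where "S = {a..b} \<times> {y :: real^'d. infnorm y \<le> R}"
  have "compact {y :: real^'d. infnorm y \<le> R}"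
  proof -
    have "closed {y :: real^'d. infnorm y \<le> R}"
      by (intro closed_Collect_le continuous_intros)
    moreover have "bounded {y :: real^'d. infnorm y \<le> R}"
    proof (rule boundedI)
      fix y :: "real^'d" assume "y \<in> {y. infnorm y \<le> R}"
      then show "norm y \<le> sqrt DIM(real^'d) * R"
        using order_trans[OF norm_le_infnorm mult_left_mono[of "infnorm y" R "sqrt DIM(real^'d)"]]
        by auto
    qed
    ultimately show ?thesis by (simp add: compact_eq_bounded_closed)
  qed
  then have S: "compact S" unfolding S_def by (intro compact_Times) auto
  have zR: "infnorm (z t) \<le> R - 1" if "t \<in> {a..b}" for t
  proof -
    have "continuous_on {a..b} z"
      using z unfolding solves_ivp_def by (auto intro: continuous_on_vector_derivative)
    then obtain B where "\<And>t. t \<in> {a..b} \<Longrightarrow> infnorm (z t) \<le> B"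
      using compact_imp_infnorm_bounded[OF compact_Icc] by metis
    then have "bdd_above ((\<lambda>t. infnorm (z t)) ` {a..b})" by (rule bdd_aboveI2)
    then show ?thesis using cSUP_upper[OF that] by (simp add: R_def)
  qed
  have "Ck_on r F S" using Ck by (simp add: F_def S_def R_def)
  then obtain \<Psi> where \<Psi>: "\<Psi> 0 = F" "\<And>k. k \<le> r \<Longrightarrow> continuous_on S (\<Psi> k)"
    "\<And>k. k < r \<Longrightarrow> flow_deriv F S (\<Psi> k) (\<Psi> (Suc k))"
    using Ck_on_flow_derivs by blast
  obtain B0 where B0: "\<forall>w\<in>S. infnorm (\<Psi> 0 w) \<le> B0"
    using compact_imp_infnorm_bounded[OF S \<Psi>(2)] by blast
  obtain Br where Br: "\<forall>w\<in>S. infnorm (\<Psi> r w) \<le> Br"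
    using compact_imp_infnorm_bounded[OF S \<Psi>(2)] by blast
  define M where "M = max 1 (max B0 Br)"
  have M: "M > 0" and M0: "\<And>w. w \<in> S \<Longrightarrow> infnorm (F w) \<le> M"
    and Mr: "\<And>w. w \<in> S \<Longrightarrow> infnorm (\<Psi> r w) \<le> M"
    using B0 Br \<Psi>(1) by (auto simp: M_def le_max_iff_disj)
  define c where "c = sqrt DIM(real^'d)"
  have c: "c \<ge> 0" "norm v \<le> c * infnorm v" for v :: "real^'d"
    using norm_le_infnorm[of v] by (auto simp: c_def)
  have smooth: "\<forall>\<^sub>F \<delta> in at_right 0. \<forall>x\<in>{a..<b}. \<forall>y. infnorm (y - z x) \<le> 1 / 2 \<longrightarrow>
       (\<exists>u G. smooth_solution f r M \<omega> x (min (x + \<delta>) b) y u G)" if \<omega>: "\<omega> > 0" for \<omega>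
  proof -
    have "uniformly_continuous_on S (\<Psi> r)"
      using compact_uniformly_continuous[OF \<Psi>(2) S] by simp
    then obtain d where d: "d > 0"
      "\<And>w w'. w \<in> S \<Longrightarrow> w' \<in> S \<Longrightarrow> dist w' w < d \<Longrightarrow> dist (\<Psi> r w') (\<Psi> r w) < \<omega>"
      using \<omega> unfolding uniformly_continuous_on_def by metis
    have "\<forall>\<^sub>F \<delta> in at_right 0. \<delta> > 0 \<and> (c * L) * \<delta> \<le> 1 / 2 \<and> L * \<delta> \<le> 1 / 2 \<and> 2 * M * \<delta> \<le> 1 / 2 \<and>
        (1 + 4 * c * M) * \<delta> \<le> d / 2"
      using d(1) by (intro eventually_conj eventually_small_mult eventually_at_right_less) auto
    then show ?thesis
    proof eventually_elim
      case (elim \<delta>)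
      show ?case
      proof (intro ballI allI impI)
        fix x y assume x: "x \<in> {a..<b}" and y: "infnorm (y - z x) \<le> 1 / 2"
        define e where "e = min (x + \<delta>) b"
        have e: "x < e" "e \<le> b" "e - x \<le> \<delta>" using x elim by (auto simp: e_def)
        have sub: "{x..e} \<subseteq> {a..b}" using x e by auto
        have "\<exists>u. solves_ivp f x e y u"
        proof (rule picard_short[where L = "c * L"])
          show "continuous_on ({x..e} \<times> UNIV) (\<lambda>(t, y). f t y)"
            using sub by (intro continuous_on_subset[OF cont]) auto
          show "norm (f t v - f t v') \<le> c * L * norm (v - v')" if "t \<in> {x..e}" for t v v'
          proof -
            have "norm (f t v - f t v') \<le> c * infnorm (f t v - f t v')" by (rule c)
            also have "\<dots> \<le> c * (L * infnorm (v - v'))"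
              using lip[of t v v'] that sub c by (intro mult_left_mono) auto
            also have "\<dots> \<le> c * (L * norm (v - v'))"
              using c L by (intro mult_left_mono infnorm_le_norm) auto
            finally show ?thesis by (simp add: mult.assoc)
          qed
          have "c * L * (e - x) \<le> c * L * \<delta>" using e c L by (intro mult_left_mono) auto
          then show "c * L * (e - x) \<le> 1 / 2" using elim by simp
        qed (use e c L in auto)
        then obtain u where u: "solves_ivp f x e y u" by blast
        have yR: "infnorm y \<le> R - 1 / 2"
          using infnorm_le_add_diff[of y "z x"] zR[of x] x y by auto
        have uy: "infnorm (u t - y) \<le> 2 * M * \<delta>" if t: "t \<in> {x..e}" for t
        proof -
          have "infnorm (u t - y) \<le> (1 + 2 * L * (e - x)) * (infnorm (u x - y) + M * (e - x))"
          proof (rule infnorm_gronwall_short[where v' = "\<lambda>t. f t (u t)"])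
            fix s assume s: "s \<in> {x..e}"
            have "((\<lambda>t. u t - y) has_vector_derivative f s (u s) - 0) (at s within {x..e})"
              using u s unfolding solves_ivp_def
              by (intro has_vector_derivative_diff has_vector_derivative_const) auto
            then show "((\<lambda>t. u t - y) has_vector_derivative f s (u s)) (at s within {x..e})"
              by simp
            have "infnorm (F (s, y)) \<le> M" using s sub yR by (intro M0) (auto simp: S_def)
            then show "infnorm (f s (u s)) \<le> L * infnorm (u s - y) + M"
              using infnorm_le_add_diff[of "f s (u s)" "f s y"] lip[of s "u s" y] s sub
              by (auto simp: F_def)
          next
            have "L * (e - x) \<le> L * \<delta>" using e L by (intro mult_left_mono) auto
            then show "L * (e - x) \<le> 1 / 2" using elim by simp
          qed (use L M t in auto)
          also have "\<dots> = (1 + 2 * (L * (e - x))) * (M * (e - x))"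
            using u by (simp add: solves_ivp_def infnorm_0)
          also have "\<dots> \<le> 2 * (M * \<delta>)"
          proof (intro mult_mono)
            have "L * (e - x) \<le> L * \<delta>" using e L by (intro mult_left_mono) auto
            then show "1 + 2 * (L * (e - x)) \<le> 2" using elim by simp
          qed (use M e in auto)
          finally show ?thesis by simp
        qed
        have uS: "(t, u t) \<in> S" if "t \<in> {x..e}" for t
        proof -
          have "infnorm (u t) \<le> infnorm y + infnorm (u t - y)" by (rule infnorm_le_add_diff)
          also have "\<dots> \<le> (R - 1 / 2) + 2 * M * \<delta>" by (intro add_mono yR uy[OF that])
          also have "\<dots> \<le> R" using elim by simp
          finally show ?thesis using that sub by (auto simp: S_def)
        qed
        define G where "G = (\<lambda>k t. \<Psi> k (t, u t))"
        have "smooth_solution f r M \<omega> x e y u G"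
          unfolding smooth_solution_def
        proof (intro conjI ballI allI impI u)
          fix t assume t: "t \<in> {x..e}"
          show "G 0 t = f t (u t)" by (simp add: G_def \<Psi>(1) F_def)
          show "infnorm (G 0 t) \<le> M" using M0[OF uS[OF t]] by (simp add: G_def \<Psi>(1))
          show "infnorm (G r t) \<le> M" using Mr[OF uS[OF t]] by (simp add: G_def)
          show "(G k has_vector_derivative G (Suc k) t) (at t within {x..e})" if "k < r" for k
            using \<Psi>(3)[OF that] t uS u unfolding flow_deriv_def solves_ivp_def G_def F_def
            by auto
          fix s assume s: "s \<in> {x..e}"
          have "dist (u s) (u t) \<le> c * infnorm (u s - u t)"
            using c(2) by (simp add: dist_norm)
          also have "\<dots> \<le> c * (2 * M * \<delta> + 2 * M * \<delta>)"
            using uy[OF s] uy[OF t] infnorm_triangle_sub[of "u s" "u t" y] infnorm_sub[of y "u t"] c(1)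
            by (intro mult_left_mono) auto
          finally have "dist (u s) (u t) \<le> 4 * c * M * \<delta>" by simp
          moreover have "dist s t \<le> \<delta>" using s t e by (auto simp: dist_real_def)
          moreover have "dist (s, u s) (t, u t) \<le> dist s t + dist (u s) (u t)"
            unfolding dist_Pair_Pair by (rule sqrt_sum_squares_le_sum) auto
          ultimately have "dist (s, u s) (t, u t) < d"
            using elim d(1) by (simp add: distrib_right)
          then have "dist (G r s) (G r t) < \<omega>"
            using d(2)[OF uS[OF t] uS[OF s]] by (simp add: G_def)
          then show "infnorm (G r s - G r t) \<le> \<omega>"
            using infnorm_le_norm[of "G r s - G r t"] by (simp add: dist_norm)
        qed
        then show "\<exists>u G. smooth_solution f r M \<omega> x (min (x + \<delta>) b) y u G"
          by (auto simp: e_def)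
      qed
    qed
  qed
  show thesis by (rule that[OF L M z lip smooth])
qed

section \<open>One step of the adaptive mesh\<close>

lemma smooth_basic_iteration_error:
  fixes f :: "real \<Rightarrow> real^'d \<Rightarrow> real^'d"
  assumes r: "r \<ge> 1" and \<sigma>\<tau>: "\<sigma> < \<tau>" "\<tau> - \<sigma> \<le> 1"
    and lip: "\<And>t y y'. t \<in> {\<sigma>..\<tau>} \<Longrightarrow> infnorm (f t y - f t y') \<le> L * infnorm (y - y')" and L: "L \<ge> 0"
    and u: "smooth_solution f r M \<omega> \<sigma> \<tau> y u G"
    and A: "\<And>t. t \<in> {\<sigma>..\<tau>} \<Longrightarrow> infnorm (G r t) \<le> fact r * A" and AM: "A \<le> M"
    and s: "well_spaced r r \<sigma> \<tau> s" and q: "q = real r * real r ^ r * L"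
    and t: "t \<in> {\<sigma>..\<tau>}"
  shows "infnorm (basic_iteration f r s \<sigma> y t - u t)
    \<le> (A + q * M * (q + 1) ^ r * (\<tau> - \<sigma>)) * (\<tau> - \<sigma>) ^ Suc r"
proof (rule basic_iteration_error[OF \<sigma>\<tau> lip L _ s _ _ AM q t])
  note u = u[unfolded smooth_solution_def]
  show "solves_ivp f \<sigma> \<tau> y u" using u by blast
  fix t assume t: "t \<in> {\<sigma>..\<tau>}"
  show "infnorm (f t (u t)) \<le> M" using u t by metis
  have "lagrange_interp r s (\<lambda>\<xi>. f \<xi> (u \<xi>)) t = lagrange_interp r s (G 0) t"
    unfolding lagrange_interp_def
    using u s by (intro sum.cong refl arg_cong2[where f = scaleR]) (auto simp: well_spaced_def)
  moreover have "infnorm (G 0 t - lagrange_interp r s (G 0) t) \<le> A * (\<tau> - \<sigma>) ^ r"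
    by (rule lagrange_remainder_le[where G = G, OF r \<sigma>\<tau>(1) _ A s t]) (use u in blast)
  moreover have "G 0 t = f t (u t)" using u t by blast
  ultimately show "infnorm (f t (u t) - lagrange_interp r s (\<lambda>\<xi>. f \<xi> (u \<xi>)) t) \<le> A * (\<tau> - \<sigma>) ^ r"
    by simp
qed

lemma smooth_basic_iteration_error_crude:
  fixes f :: "real \<Rightarrow> real^'d \<Rightarrow> real^'d"
  assumes r: "r \<ge> 1" and \<sigma>\<tau>: "\<sigma> < \<tau>" "\<tau> - \<sigma> \<le> 1"
    and lip: "\<And>t y y'. t \<in> {\<sigma>..\<tau>} \<Longrightarrow> infnorm (f t y - f t y') \<le> L * infnorm (y - y')" and L: "L \<ge> 0"
    and u: "smooth_solution f r M \<omega> \<sigma> \<tau> y u G"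
    and s: "well_spaced r r \<sigma> \<tau> s" and q: "q = real r * real r ^ r * L"
    and t: "t \<in> {\<sigma>..\<tau>}"
  shows "infnorm (basic_iteration f r s \<sigma> y t - u t) \<le> M * (q + 1) ^ Suc r * (\<tau> - \<sigma>) ^ Suc r"
proof -
  have Gr: "infnorm (G r t) \<le> M" if "t \<in> {\<sigma>..\<tau>}" for t
    using u that by (simp add: smooth_solution_def)
  have M0: "0 \<le> M" using Gr[OF t] infnorm_pos_le order_trans by blast
  have q0: "0 \<le> q" using L by (simp add: q)
  have "M \<le> fact r * M" using mult_right_mono[OF fact_ge_1 M0, of r] by simp
  then have "infnorm (basic_iteration f r s \<sigma> y t - u t)
      \<le> (M + q * M * (q + 1) ^ r * (\<tau> - \<sigma>)) * (\<tau> - \<sigma>) ^ Suc r"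
    using Gr by (intro smooth_basic_iteration_error[OF r \<sigma>\<tau> lip L u _ _ s q t]) (auto intro: order_trans)
  also have "\<dots> \<le> (M * (q + 1) ^ r + q * M * (q + 1) ^ r * 1) * (\<tau> - \<sigma>) ^ Suc r"
  proof (intro mult_right_mono add_mono mult_left_mono)
    show "M \<le> M * (q + 1) ^ r"
      using mult_left_mono[OF one_le_power[of "q + 1" r] M0] q0 by simp
  qed (use \<sigma>\<tau> M0 q0 in auto)
  also have "\<dots> = M * (q + 1) ^ Suc r * (\<tau> - \<sigma>) ^ Suc r"
    by (simp add: algebra_simps)
  finally show ?thesis .
qed

text \<open>
  Differencing loses \<open>r\<close> powers of the step length, but \<open>f(t, l(t))\<close> agrees with \<open>u'\<close> to order
  \<open>r + 1\<close>, so one power is left.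
\<close>
lemma trial_divdiff_close:
  fixes f :: "real \<Rightarrow> real^'d \<Rightarrow> real^'d"
  assumes r: "r \<ge> 1" and \<sigma>\<tau>: "\<sigma> < \<tau>" "\<tau> - \<sigma> \<le> 1"
    and lip: "\<And>t y y'. t \<in> {\<sigma>..\<tau>} \<Longrightarrow> infnorm (f t y - f t y') \<le> L * infnorm (y - y')" and L: "L \<ge> 0"
    and u: "smooth_solution f r M \<omega> \<sigma> \<tau> y u G"
    and s: "well_spaced (Suc r) r \<sigma> \<tau> s" and q: "q = real r * real r ^ r * L"
  shows "infnorm (divdiff (\<lambda>t. f t (basic_iteration f r s \<sigma> y t)) s r 0 - divdiff (G 0) s r 0)
    \<le> (2 * real r) ^ r * L * (M * (q + 1) ^ Suc r) * (\<tau> - \<sigma>)"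
proof -
  define h where "h = \<tau> - \<sigma>"
  define K where "K = M * (q + 1) ^ Suc r"
  have h: "h > 0" using \<sigma>\<tau> by (simp add: h_def)
  have "infnorm (divdiff (\<lambda>t. f t (basic_iteration f r s \<sigma> y t)) s r 0 - divdiff (G 0) s r 0)
      \<le> (2 / (h / real r)) ^ r * (L * (K * h ^ Suc r))"
  proof (rule divdiff_diff_le)
    fix j assume "j \<in> {0..0 + r}"
    then have sj: "s j \<in> {\<sigma>..\<tau>}" using s by (simp add: well_spaced_def)
    then have "G 0 (s j) = f (s j) (u (s j))" using u by (simp add: smooth_solution_def)
    then have "infnorm (f (s j) (basic_iteration f r s \<sigma> y (s j)) - G 0 (s j))
        \<le> L * infnorm (basic_iteration f r s \<sigma> y (s j) - u (s j))"
      using lip[OF sj] by simp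
    also have "\<dots> \<le> L * (K * h ^ Suc r)"
      unfolding K_def h_def using well_spaced_mono[OF s, of r]
      by (intro mult_left_mono smooth_basic_iteration_error_crude[OF r \<sigma>\<tau> lip L u _ q sj] L) auto
    finally show "infnorm (f (s j) (basic_iteration f r s \<sigma> y (s j)) - G 0 (s j)) \<le> L * (K * h ^ Suc r)" .
  qed (use s r h in \<open>auto simp: well_spaced_def h_def\<close>)
  also have "\<dots> = (2 * real r) ^ r * L * K * h"
    using h by (simp add: power_divide power_mult_distrib)
  finally show ?thesis by (simp add: K_def h_def)
qed

text \<open>
  The components of the computed divided difference, whose norm is \<open>D\<close>, are values of the
  components of \<open>u^(r+1) / r!\<close> up to \<open>\<beta> / 4\<close>; the oscillation of \<open>u^(r+1)\<close> costs another
  \<open>\<beta> / 4\<close>, and the propagated error of the basic iteration \<open>\<beta> / 2\<close>.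
\<close>
lemma adaptive_step_error:
  fixes f :: "real \<Rightarrow> real^'d \<Rightarrow> real^'d"
  assumes r: "r \<ge> 1" and x: "x < x'" "x' \<le> e" "x < xb" "xb \<le> e" and e: "e - x \<le> \<delta>" "\<delta> \<le> 1"
    and lip: "\<And>t y y'. t \<in> {x..e} \<Longrightarrow> infnorm (f t y - f t y') \<le> L * infnorm (y - y')" and L: "L \<ge> 0"
    and u: "smooth_solution f r M \<omega> x e y u G"
    and q: "q = real r * real r ^ r * L"
    and small: "(2 * real r) ^ r * L * (M * (q + 1) ^ Suc r) * \<delta> \<le> \<beta> / 4"
      "\<omega> \<le> \<beta> / 4" "q * M * (q + 1) ^ r * \<delta> \<le> \<beta> / 2"
    and D: "D = infnorm (divdiff (\<lambda>t. f t (basic_iteration f r (trial_node r x xb) x y t)) (trial_node r x xb) r 0)"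
  shows "D \<le> M + \<beta>"
    and "t \<in> {x..x'} \<Longrightarrow> infnorm (basic_iteration f r (node r x x') x y t - u t) \<le> (D + \<beta>) * (x' - x) ^ Suc r"
proof -
  define Q where "Q = divdiff (G 0) (trial_node r x xb) r 0"
  define V where "V = divdiff (\<lambda>t. f t (basic_iteration f r (trial_node r x xb) x y t)) (trial_node r x xb) r 0"
  have sub: "{x..xb} \<subseteq> {x..e}" "{x..x'} \<subseteq> {x..e}" using x by auto
  have ub: "smooth_solution f r M \<omega> x xb y u G" and u': "smooth_solution f r M \<omega> x x' y u G"
    using smooth_solution_restrict[OF u] x by auto
  have xe: "x \<in> {x..e}" using x by simp
  have "infnorm (G r x) \<le> M" using u xe by (simp add: smooth_solution_def)
  then have M0: "0 \<le> M" using order_trans[OF infnorm_pos_le] by blast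
  have q0: "0 \<le> q" using L by (simp add: q)
  define K where "K = (2 * real r) ^ r * L * (M * (q + 1) ^ Suc r)"
  have K0: "0 \<le> K" using L M0 q0 by (simp add: K_def)
  have "infnorm (V - Q)
      \<le> K * (xb - x)"
    unfolding K_def Q_def V_def
    by (rule trial_divdiff_close[OF r x(3) _ lip L ub well_spaced_trial_node[OF x(3) r] q])
       (use x e in auto)
  also have "\<dots> \<le> K * \<delta>" using K0 x e by (intro mult_left_mono) auto
  also have "\<dots> \<le> \<beta> / 4" using small by (simp add: K_def)
  finally have DQ: "infnorm (V - Q) \<le> \<beta> / 4" .
  then have D1: "D \<le> infnorm Q + \<beta> / 4" and D2: "infnorm Q \<le> D + \<beta> / 4"
    unfolding D V_def[symmetric]
    using infnorm_le_add_diff[of V Q] infnorm_le_add_diff[of Q V] infnorm_sub[of Q V] by linarith+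
  have \<beta>0: "0 \<le> \<beta>" using DQ infnorm_pos_le[of "V - Q"] by linarith
  have mean: "\<exists>\<theta>\<in>{x..e}. G r \<theta> \<bullet> b = fact r * (Q \<bullet> b)" if "b \<in> Basis" for b
  proof -
    have "\<exists>\<theta>\<in>{x..xb}. G r \<theta> \<bullet> b = fact r * (Q \<bullet> b)"
      unfolding Q_def
      by (rule divdiff_derivative[OF r x(3) _ well_spaced_trial_node[OF x(3) r] that])
         (use ub in \<open>simp add: smooth_solution_def\<close>)
    then show ?thesis using sub by blast
  qed
  have "infnorm Q \<le> M"
    unfolding infnorm_le_iff
  proof
    fix b :: "real^'d" assume b: "b \<in> Basis"
    obtain \<theta> where \<theta>: "\<theta> \<in> {x..e}" "G r \<theta> \<bullet> b = fact r * (Q \<bullet> b)" using mean[OF b] by blast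
    have "\<bar>G r \<theta> \<bullet> b\<bar> \<le> M"
      using u \<theta>(1) b by (simp add: smooth_solution_def infnorm_le_iff)
    moreover have "1 * \<bar>Q \<bullet> b\<bar> \<le> fact r * \<bar>Q \<bullet> b\<bar>"
      by (intro mult_right_mono fact_ge_1) simp
    ultimately show "\<bar>Q \<bullet> b\<bar> \<le> M" by (simp add: \<theta>(2) abs_mult)
  qed
  then show "D \<le> M + \<beta>" using D1 \<beta>0 by simp
  \<comment> \<open>The minimum with \<open>M\<close> keeps \<open>A\<close> below the uniform bound that controls the earlier sweeps.\<close>
  define A where "A = min M (D + \<beta> / 2)"
  have GA: "infnorm (G r t) \<le> fact r * A" if t: "t \<in> {x..e}" for t
  proof -
    have "infnorm (G r t) \<le> M" using u t by (simp add: smooth_solution_def)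
    also have "M \<le> fact r * M" using mult_right_mono[OF fact_ge_1 M0, of r] by simp
    finally have 1: "infnorm (G r t) \<le> fact r * M" .
    have 2: "infnorm (G r t) \<le> fact r * (D + \<beta> / 2)"
      unfolding infnorm_le_iff
    proof
      fix b :: "real^'d" assume b: "b \<in> Basis"
      obtain \<theta> where \<theta>: "\<theta> \<in> {x..e}" "G r \<theta> \<bullet> b = fact r * (Q \<bullet> b)" using mean[OF b] by blast
      have "infnorm (G r t - G r \<theta>) \<le> \<omega>"
        using u t \<theta>(1) by (simp add: smooth_solution_def)
      then have "\<bar>G r t \<bullet> b - G r \<theta> \<bullet> b\<bar> \<le> \<omega>"
        using b by (simp add: infnorm_le_iff inner_diff_left)
      then have "\<bar>G r t \<bullet> b\<bar> \<le> fact r * \<bar>Q \<bullet> b\<bar> + \<omega>"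
        unfolding \<theta>(2) using abs_mult[of "fact r" "Q \<bullet> b"] by simp
      also have "\<dots> \<le> fact r * (D + \<beta> / 4) + fact r * (\<beta> / 4)"
      proof (intro add_mono mult_left_mono)
        have "\<bar>Q \<bullet> b\<bar> \<le> infnorm Q" using b by (rule Basis_le_infnorm)
        then show "\<bar>Q \<bullet> b\<bar> \<le> D + \<beta> / 4" using D2 by simp
        have "1 * (\<beta> / 4) \<le> fact r * (\<beta> / 4)" using \<beta>0 by (intro mult_right_mono fact_ge_1) simp
        then show "\<omega> \<le> fact r * (\<beta> / 4)" using small(2) by simp
      qed simp
      also have "\<dots> = fact r * (D + \<beta> / 2)" by (simp add: algebra_simps)
      finally show "\<bar>G r t \<bullet> b\<bar> \<le> fact r * (D + \<beta> / 2)" .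
    qed
    show ?thesis using 1 2 by (simp add: A_def min_def)
  qed
  assume t: "t \<in> {x..x'}"
  have "infnorm (basic_iteration f r (node r x x') x y t - u t)
      \<le> (A + q * M * (q + 1) ^ r * (x' - x)) * (x' - x) ^ Suc r"
    by (rule smooth_basic_iteration_error[OF r x(1) _ lip L u' GA _ well_spaced_node[OF x(1) r] q t])
       (use x e sub in \<open>auto simp: A_def\<close>)
  also have "\<dots> \<le> (D + \<beta>) * (x' - x) ^ Suc r"
  proof (rule mult_right_mono)
    have "q * M * (q + 1) ^ r * (x' - x) \<le> q * M * (q + 1) ^ r * \<delta>"
      using q0 M0 x e by (intro mult_left_mono) auto
    then show "A + q * M * (q + 1) ^ r * (x' - x) \<le> D + \<beta>"
      using small(3) by (auto simp: A_def)
  qed (use x in simp)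
  finally show "infnorm (basic_iteration f r (node r x x') x y t - u t) \<le> (D + \<beta>) * (x' - x) ^ Suc r" .
qed

text \<open>
  Since \<open>D + \<beta> \<le> G\<close>, the step length \<open>(\<epsilon> / G)^(1/(r+1))\<close> turns the previous estimate into the
  bound \<open>\<epsilon>\<close>. Since \<open>\<beta> \<le> G\<close>, the step is at most \<open>\<delta>\<close> for small \<open>\<epsilon>\<close>; since \<open>G\<close> is
  bounded above by \<open>M\<close>, \<open>\<beta>\<close> and \<open>\<phi>\<close>, it is bounded below unless it is cut off at \<open>b\<close>. The
  second error bound, linear in the step length, is the one that can be summed over the mesh.
\<close>
lemma mesh_step:
  fixes f :: "real \<Rightarrow> real^'d \<Rightarrow> real^'d"
  assumes r: "r \<ge> 1" and \<epsilon>: "\<epsilon> > 0" and \<beta>: "\<beta> > 0" and \<phi>: "\<phi> > 0" and x: "x < b"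
    and h: "0 < h \<epsilon>" "h \<epsilon> \<le> \<delta>" and \<epsilon>\<delta>: "(\<epsilon> / \<beta>) powr (1 / (real r + 1)) \<le> \<delta>" and \<delta>: "\<delta> \<le> 1"
    and lip: "\<And>t y y'. t \<in> {x..b} \<Longrightarrow> infnorm (f t y - f t y') \<le> L * infnorm (y - y')" and L: "L \<ge> 0"
    and u: "smooth_solution f r M \<omega> x (min (x + \<delta>) b) y u G"
    and q: "q = real r * real r ^ r * L"
    and small: "(2 * real r) ^ r * L * (M * (q + 1) ^ Suc r) * \<delta> \<le> \<beta> / 4"
      "\<omega> \<le> \<beta> / 4" "q * M * (q + 1) ^ r * \<delta> \<le> \<beta> / 2"
    and x': "x' = next_x f b r \<beta> \<phi> h \<epsilon> x y"
    and l: "l = local_approx f b r \<beta> \<phi> h \<epsilon> x y"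
  shows "x < x'" and "x' \<le> min (x + \<delta>) b"
    and "t \<in> {x..x'} \<Longrightarrow> infnorm (l t - u t) \<le> \<epsilon>"
    and "infnorm (l x' - u x') \<le> (M + 2 * \<beta>) * \<delta> * (x' - x)"
    and "x' < b \<Longrightarrow> x + (\<epsilon> / (8 / 3 * (M + 2 * \<beta>) * (1 + \<phi>))) powr (1 / (real r + 1)) \<le> x'"
proof -
  define e where "e = min (x + \<delta>) b"
  define xb where "xb = trial_end b h \<epsilon> x"
  define D where "D = infnorm (divdiff (\<lambda>t. f t (basic_iteration f r (trial_node r x xb) x y t)) (trial_node r x xb) r 0)"
  define g where "g = mesh_G f b r \<beta> \<phi> h \<epsilon> x y"
  define p where "p = (\<epsilon> / g) powr (1 / (real r + 1))"
  have g: "g = 8 / 3 * (D + \<beta>) * (1 + \<phi>)"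
    by (simp add: g_def mesh_G_def D_def xb_def Let_def)
  have D0: "0 \<le> D" by (simp add: D_def infnorm_pos_le)
  have "1 * (D + \<beta>) \<le> (8 / 3 * (1 + \<phi>)) * (D + \<beta>)"
    using D0 \<beta> \<phi> by (intro mult_right_mono) auto
  also have "(8 / 3 * (1 + \<phi>)) * (D + \<beta>) = g" by (simp add: g algebra_simps)
  finally have gD: "D + \<beta> \<le> g" by simp
  then have g0: "\<beta> \<le> g" "0 < g" using D0 \<beta> by auto
  have pd: "p \<le> \<delta>"
  proof -
    have "p \<le> (\<epsilon> / \<beta>) powr (1 / (real r + 1))"
      unfolding p_def using \<epsilon> \<beta> g0 by (intro powr_mono2 frac_le) auto
    then show ?thesis using \<epsilon>\<delta> by simp
  qed
  have p0: "p > 0" using \<epsilon> g0 by (simp add: p_def)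
  have x'p: "x' = x + min p (b - x)" by (simp add: x' next_x_def p_def g_def)
  show xx': "x < x'" and x'e: "x' \<le> min (x + \<delta>) b" using x'p p0 pd x by auto
  have xb: "x < xb" "xb \<le> e" using h x by (auto simp: xb_def trial_end_def e_def)
  have e: "x' \<le> e" "e - x \<le> \<delta>" "e \<le> b" using x'e by (auto simp: e_def)
  have lip': "infnorm (f t y - f t y') \<le> L * infnorm (y - y')" if "t \<in> {x..e}" for t y y'
    using lip that e by auto
  have u': "smooth_solution f r M \<omega> x e y u G" using u by (simp add: e_def)
  note step = adaptive_step_error[OF r xx' e(1) xb e(2) \<delta> lip' L u' q small D_def]
  have leq: "l = basic_iteration f r (node r x x') x y" by (simp add: l local_approx_def x')
  have DM: "D \<le> M + \<beta>" by (rule step(1))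
  define d where "d = x' - x"
  have d: "0 < d" "d \<le> p" "d \<le> \<delta>" using xx' x'p pd by (auto simp: d_def)
  have err: "infnorm (l t - u t) \<le> (D + \<beta>) * d ^ Suc r" if "t \<in> {x..x'}" for t
    unfolding leq d_def by (rule step(2)[OF _ that])
  show "infnorm (l t - u t) \<le> \<epsilon>" if t: "t \<in> {x..x'}"
  proof -
    have "d ^ Suc r \<le> p ^ Suc r" using d by (intro power_mono) auto
    also have "p ^ Suc r = (\<epsilon> / g) powr (real (Suc r) * (1 / (real r + 1)))"
      unfolding p_def using \<epsilon> g0 by (intro powr_power) auto
    also have "real (Suc r) * (1 / (real r + 1)) = 1" by simp
    also have "(\<epsilon> / g) powr 1 = \<epsilon> / g" using \<epsilon> g0 by simp
    finally have dg: "d ^ Suc r \<le> \<epsilon> / g" .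
    have "(D + \<beta>) * d ^ Suc r \<le> g * (\<epsilon> / g)"
      using gD dg d g0 by (intro mult_mono) auto
    then show ?thesis using err[OF t] g0 by simp
  qed
  show "infnorm (l x' - u x') \<le> (M + 2 * \<beta>) * \<delta> * (x' - x)"
  proof -
    have "d ^ r \<le> d ^ 1" using d \<delta> r by (intro power_decreasing) auto
    then have "d ^ r * d \<le> \<delta> * d" using d by (intro mult_right_mono) auto
    then have le: "d ^ Suc r \<le> \<delta> * d" by (simp add: mult.commute)
    have "infnorm (l x' - u x') \<le> (D + \<beta>) * d ^ Suc r"
      using xx' by (intro err) simp
    also have "\<dots> \<le> (M + 2 * \<beta>) * (\<delta> * d)"
      using le DM D0 \<beta> d by (intro mult_mono) auto
    finally show ?thesis by (simp add: d_def mult.assoc)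
  qed
  show "x + (\<epsilon> / (8 / 3 * (M + 2 * \<beta>) * (1 + \<phi>))) powr (1 / (real r + 1)) \<le> x'" if "x' < b"
  proof -
    have "8 / 3 * (D + \<beta>) * (1 + \<phi>) \<le> 8 / 3 * (M + 2 * \<beta>) * (1 + \<phi>)"
      using DM \<phi> by (intro mult_right_mono mult_left_mono) auto
    then have "(\<epsilon> / (8 / 3 * (M + 2 * \<beta>) * (1 + \<phi>))) powr (1 / (real r + 1)) \<le> p"
      unfolding p_def g[symmetric] using \<epsilon> g0(2) by (intro powr_mono2 frac_le) auto
    then show ?thesis using x'p that by auto
  qed
qed

section \<open>Propagation of the error and termination\<close>

theorem mainTheorem3:
  fixes a b :: real and \<eta> :: "real^'d" and r :: nat
    and f :: "real \<Rightarrow> real^'d \<Rightarrow> real^'d"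
    and \<beta> \<phi> :: real and h :: "real \<Rightarrow> real"
  assumes "a < b" and "r \<ge> 1"
    and "f \<in> class_F a b \<eta> r"
    and "\<beta> > 0" and "0 < \<phi>" and "\<phi> < 1"
    and "\<forall>\<epsilon>\<in>{0<..<1}. h \<epsilon> > 0"
    and "h \<in> O[at_right 0](\<lambda>\<epsilon>. \<epsilon> powr (1 / (real r + 1)))"
  shows "\<exists>\<epsilon>\<^sub>0>0. \<forall>\<epsilon>. 0 < \<epsilon> \<and> \<epsilon> < 1 \<and> \<epsilon> \<le> \<epsilon>\<^sub>0 \<longrightarrow>
    (let x = (\<lambda>i. fst (adapt_mesh f a b \<eta> r \<beta> \<phi> h \<epsilon> i));
         y = (\<lambda>i. snd (adapt_mesh f a b \<eta> r \<beta> \<phi> h \<epsilon> i));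
         l = (\<lambda>i. local_approx f b r \<beta> \<phi> h \<epsilon> (x i) (y i))
     in \<exists>m. x 0 = a \<and> (\<forall>i<m. x i < x (Suc i)) \<and> x m = b \<and>
          (\<forall>i<m. \<forall>z. solves_ivp f (x i) (x (Suc i)) (y i) z \<longrightarrow>
             (SUP t\<in>{x i..x (Suc i)}. infnorm (z t - l i t)) \<le> \<epsilon>))"
proof -
  note ab = assms(1) and r = assms(2) and \<beta> = assms(4) and \<phi> = assms(5)
  obtain L M z where L: "L \<ge> 0" and M: "M > 0" and z: "solves_ivp f a b \<eta> z"
    and lip: "\<And>t y y'. t \<in> {a..b} \<Longrightarrow> infnorm (f t y - f t y') \<le> L * infnorm (y - y')"
    and smooth: "\<And>\<omega>. \<omega> > 0 \<Longrightarrow> \<forall>\<^sub>F \<delta> in at_right 0. \<forall>x\<in>{a..<b}. \<forall>y. infnorm (y - z x) \<le> 1 / 2 \<longrightarrow>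
       (\<exists>u G. smooth_solution f r M \<omega> x (min (x + \<delta>) b) y u G)"
    by (rule class_F_smooth_local_solutions[OF ab assms(3)]) (rule that)
  define q where "q = real r * real r ^ r * L"
  define E where "E = exp (2 * L * (b - a)) * (M + 2 * \<beta>)"
  define good where "good = (\<lambda>\<delta>. \<delta> > 0 \<and> 1 * \<delta> \<le> 1 \<and> L * \<delta> \<le> 1 / 2 \<and>
      (2 * real r) ^ r * L * (M * (q + 1) ^ Suc r) * \<delta> \<le> \<beta> / 4 \<and>
      q * M * (q + 1) ^ r * \<delta> \<le> \<beta> / 2 \<and> (E * (b - a)) * \<delta> \<le> 1 / 2 \<and>
      (\<forall>x\<in>{a..<b}. \<forall>y. infnorm (y - z x) \<le> 1 / 2 \<longrightarrow>
       (\<exists>u G. smooth_solution f r M (\<beta> / 4) x (min (x + \<delta>) b) y u G)))"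
  have "\<forall>\<^sub>F \<delta> in at_right 0. good \<delta>"
    unfolding good_def using \<beta>
    by (intro eventually_conj eventually_small_mult smooth eventually_at_right_less) auto
  then obtain \<delta> where "good \<delta>"
    using eventually_happens'[OF trivial_limit_at_right_real] by blast
  then have \<delta>: "\<delta> > 0" "\<delta> \<le> 1" "L * \<delta> \<le> 1 / 2"
    and small: "(2 * real r) ^ r * L * (M * (q + 1) ^ Suc r) * \<delta> \<le> \<beta> / 4"
      "q * M * (q + 1) ^ r * \<delta> \<le> \<beta> / 2" and E\<delta>: "E * (b - a) * \<delta> \<le> 1 / 2"
    and local_solution: "\<And>x y. x \<in> {a..<b} \<Longrightarrow> infnorm (y - z x) \<le> 1 / 2 \<Longrightarrow>
       \<exists>u G. smooth_solution f r M (\<beta> / 4) x (min (x + \<delta>) b) y u G"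
    unfolding good_def by (simp_all only: mult_1)
  have lim: "((\<lambda>\<epsilon>. (\<epsilon> / c) powr (1 / (real r + 1))) \<longlongrightarrow> 0) (at_right 0)" if "c > 0" for c :: real
  proof (rule tendsto_zero_powrI)
    show "((\<lambda>\<epsilon>. \<epsilon> / c) \<longlongrightarrow> 0) (at_right 0)"
      using that by (auto intro!: tendsto_eq_intros)
    show "\<forall>\<^sub>F \<epsilon> in at_right 0. 0 \<le> \<epsilon> / c"
      using eventually_at_right_less[of "0::real"] by eventually_elim (use that in simp)
  qed (rule tendsto_const, simp)
  have "\<forall>\<^sub>F \<epsilon> in at_right 0. h \<epsilon> < \<delta>"
  proof -
    obtain c where c: "\<forall>\<^sub>F \<epsilon> in at_right 0. norm (h \<epsilon>) \<le> c * norm (\<epsilon> powr (1 / (real r + 1)))"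
      using assms(8) by (rule landau_o.bigE)
    have "((\<lambda>\<epsilon>. c * norm (\<epsilon> powr (1 / (real r + 1)))) \<longlongrightarrow> 0) (at_right 0)"
      using tendsto_mult[OF tendsto_const[of c] tendsto_norm[OF lim[of 1]]] by simp
    then have "\<forall>\<^sub>F \<epsilon> in at_right 0. c * norm (\<epsilon> powr (1 / (real r + 1))) < \<delta>"
      using \<delta>(1) by (rule order_tendstoD)
    with c show ?thesis by eventually_elim auto
  qed
  moreover have "\<forall>\<^sub>F \<epsilon> in at_right 0. (\<epsilon> / \<beta>) powr (1 / (real r + 1)) < \<delta>"
    using lim[OF \<beta>] \<delta>(1) by (rule order_tendstoD)
  ultimately have "\<forall>\<^sub>F \<epsilon> in at_right 0. h \<epsilon> < \<delta> \<and> (\<epsilon> / \<beta>) powr (1 / (real r + 1)) < \<delta>"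
    by (rule eventually_conj)
  then obtain \<epsilon>1 where \<epsilon>1: "\<epsilon>1 > 0"
    "\<And>\<epsilon>. 0 < \<epsilon> \<Longrightarrow> \<epsilon> < \<epsilon>1 \<Longrightarrow> h \<epsilon> < \<delta> \<and> (\<epsilon> / \<beta>) powr (1 / (real r + 1)) < \<delta>"
    unfolding eventually_at_right_field by blast
  show ?thesis
  proof (intro exI[of _ "\<epsilon>1 / 2"] conjI allI impI)
    show "\<epsilon>1 / 2 > 0" using \<epsilon>1 by simp
    fix \<epsilon> assume \<epsilon>: "0 < \<epsilon> \<and> \<epsilon> < 1 \<and> \<epsilon> \<le> \<epsilon>1 / 2"
    then have h: "0 < h \<epsilon>" "h \<epsilon> \<le> \<delta>" and \<epsilon>\<delta>: "(\<epsilon> / \<beta>) powr (1 / (real r + 1)) \<le> \<delta>"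
      using \<epsilon>1(2)[of \<epsilon>] \<epsilon>1(1) assms(7) by auto
    define x where "x = (\<lambda>i. fst (adapt_mesh f a b \<eta> r \<beta> \<phi> h \<epsilon> i))"
    define y where "y = (\<lambda>i. snd (adapt_mesh f a b \<eta> r \<beta> \<phi> h \<epsilon> i))"
    define l where "l = (\<lambda>i. local_approx f b r \<beta> \<phi> h \<epsilon> (x i) (y i))"
    \<comment> \<open>Lower bound for all steps but the last.\<close>
    define \<kappa> where "\<kappa> = (\<epsilon> / (8 / 3 * (M + 2 * \<beta>) * (1 + \<phi>))) powr (1 / (real r + 1))"
    have \<kappa>: "\<kappa> > 0" using \<epsilon> M \<beta> \<phi> by (simp add: \<kappa>_def)
    have init: "x 0 = a" "y 0 = \<eta>" by (simp_all add: x_def y_def)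
    have Suc1: "x (Suc i) = next_x f b r \<beta> \<phi> h \<epsilon> (x i) (y i)" "y (Suc i) = l i (x (Suc i))"
      if "x i < b" for i
      using that by (auto simp: x_def y_def l_def Let_def split: prod.splits)
    have Suc2: "x (Suc i) = x i" "y (Suc i) = y i" if "\<not> x i < b" for i
      using that by (auto simp: x_def y_def Let_def split: prod.splits)
    \<comment> \<open>Bound for the global error: \<open>(M + 2 \<beta>) \<delta>\<close> per unit length, amplified by \<open>exp (2 L)\<close> per
      unit length. The choice of \<open>\<delta>\<close> keeps it below \<open>1/2\<close> up to \<open>b\<close>.\<close>
    define e where "e = (\<lambda>i. exp (2 * L * (x i - a)) * ((M + 2 * \<beta>) * \<delta> * (x i - a)))"
    have e_half: "e i \<le> 1 / 2" if "a \<le> x i" "x i \<le> b" for i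
    proof -
      have "e i \<le> exp (2 * L * (b - a)) * ((M + 2 * \<beta>) * \<delta> * (b - a))"
        unfolding e_def using that L M \<beta> \<delta>
        by (intro mult_mono) (auto intro!: mult_left_mono)
      then show ?thesis using E\<delta> by (simp add: E_def mult_ac)
    qed
    have step: "x i < x (Suc i)" "x (Suc i) \<le> b"
      "\<And>u t. solves_ivp f (x i) (x (Suc i)) (y i) u \<Longrightarrow> t \<in> {x i..x (Suc i)} \<Longrightarrow> infnorm (l i t - u t) \<le> \<epsilon>"
      "infnorm (y (Suc i) - z (x (Suc i))) \<le> e (Suc i)"
      "x (Suc i) < b \<Longrightarrow> x i + \<kappa> \<le> x (Suc i)"
      if i: "a \<le> x i" "x i < b" "infnorm (y i - z (x i)) \<le> e i" for i
    proof -
      have half: "infnorm (y i - z (x i)) \<le> 1 / 2" using e_half[of i] i by auto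
      then obtain u G where u: "smooth_solution f r M (\<beta> / 4) (x i) (min (x i + \<delta>) b) (y i) u G"
        using local_solution[of "x i" "y i"] i by auto
      have lip': "infnorm (f t y - f t y') \<le> L * infnorm (y - y')" if "t \<in> {x i..b}" for t y y'
        using lip that i by auto
      note S = mesh_step[OF r conjunct1[OF \<epsilon>] \<beta> \<phi> i(2) h \<epsilon>\<delta> \<delta>(2) lip' L u q_def small(1) order_refl small(2)
          Suc1(1)[OF i(2)] l_def[THEN fun_cong]]
      show S1: "x i < x (Suc i)" and S2: "x (Suc i) \<le> b" using S(1,2) by auto
      show "x (Suc i) < b \<Longrightarrow> x i + \<kappa> \<le> x (Suc i)" using S(5) by (simp add: \<kappa>_def)
      define d where "d = x (Suc i) - x i"
      have d: "0 < d" "d \<le> \<delta>" using S(1,2) by (auto simp: d_def)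
      have Ld: "L * d \<le> 1 / 2"
        using mult_left_mono[OF d(2) L] \<delta>(3) by simp
      have u1: "solves_ivp f (x i) (x (Suc i)) (y i) u"
        using smooth_solution_restrict[OF u S(2)] by (simp add: smooth_solution_def)
      have lip'': "infnorm (f t y - f t y') \<le> L * infnorm (y - y')" if "t \<in> {x i..x (Suc i)}" for t y y'
        using lip' that S2 by auto
      note stab = solves_ivp_stability[OF _ u1 lip'' L Ld[unfolded d_def]]
      show "infnorm (l i t - v t) \<le> \<epsilon>"
        if v: "solves_ivp f (x i) (x (Suc i)) (y i) v" and t: "t \<in> {x i..x (Suc i)}" for v t
      proof -
        have "infnorm (v t - u t) \<le> 0" using stab[OF v _ t] by (simp add: infnorm_0)
        then have "v t = u t" using infnorm_pos_lt[of "v t - u t"] by (metis eq_iff_diff_eq_0 not_less)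
        then show ?thesis using S(3)[OF _ t] by simp
      qed
      have zi: "solves_ivp f (x i) (x (Suc i)) (z (x i)) z"
        using solves_ivp_restrict[OF z i(1) S2] .
      have "infnorm (z (x (Suc i)) - u (x (Suc i))) \<le> (1 + 2 * L * d) * infnorm (z (x i) - y i)"
        using stab[OF zi _, of "x (Suc i)"] S1 by (simp add: d_def)
      also have "\<dots> \<le> exp (2 * L * d) * e i"
        using i(3) L d exp_ge_add_one_self[of "2 * L * d"]
        by (intro mult_mono) (auto simp: infnorm_sub infnorm_pos_le)
      finally have 1: "infnorm (z (x (Suc i)) - u (x (Suc i))) \<le> exp (2 * L * d) * e i" .
      have "infnorm (y (Suc i) - u (x (Suc i))) \<le> (M + 2 * \<beta>) * \<delta> * d"
        using S(4) by (simp add: Suc1(2)[OF i(2)] d_def)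
      also have "\<dots> = 1 * ((M + 2 * \<beta>) * \<delta> * d)" by simp
      also have "\<dots> \<le> exp (2 * L * (x (Suc i) - a)) * ((M + 2 * \<beta>) * \<delta> * d)"
        using L S1 i M \<beta> \<delta> d by (intro mult_right_mono) auto
      finally have 2: "infnorm (y (Suc i) - u (x (Suc i)))
          \<le> exp (2 * L * (x (Suc i) - a)) * ((M + 2 * \<beta>) * \<delta> * d)" .
      have "exp (2 * L * d) * exp (2 * L * (x i - a)) = exp (2 * L * (x (Suc i) - a))"
        unfolding mult_exp_exp d_def by (rule arg_cong[where f = exp]) (simp add: algebra_simps)
      then have "exp (2 * L * d) * e i = exp (2 * L * (x (Suc i) - a)) * ((M + 2 * \<beta>) * \<delta> * (x i - a))"
        unfolding e_def by (metis mult.assoc)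
      also have "\<dots> + exp (2 * L * (x (Suc i) - a)) * ((M + 2 * \<beta>) * \<delta> * d) = e (Suc i)"
        unfolding e_def d_def distrib_left[symmetric] by (simp add: distrib_left[symmetric])
      finally have "exp (2 * L * d) * e i
          + exp (2 * L * (x (Suc i) - a)) * ((M + 2 * \<beta>) * \<delta> * d) = e (Suc i)" .
      then show "infnorm (y (Suc i) - z (x (Suc i))) \<le> e (Suc i)"
        using 1 2 infnorm_triangle_sub[of "y (Suc i)" "z (x (Suc i))" "u (x (Suc i))"]
        by (simp add: infnorm_sub)
    qed
    have inv: "a \<le> x i \<and> x i \<le> b \<and> infnorm (y i - z (x i)) \<le> e i \<and> (x i < b \<longrightarrow> a + real i * \<kappa> \<le> x i)" for i
    proof (induction i)
      case 0
      then show ?case using ab z by (simp add: init e_def solves_ivp_def infnorm_0)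
    next
      case (Suc i)
      show ?case
      proof (cases "x i < b")
        case True
        then show ?thesis using Suc step[of i] by (auto simp: algebra_simps)
      next
        case False
        have "e (Suc i) = e i" by (simp add: e_def Suc2[OF False])
        then show ?thesis using Suc False unfolding Suc2[OF False] by metis
      qed
    qed
    have "\<exists>m. x m = b"
    proof (rule ccontr)
      assume "\<not> ?thesis"
      then have "x i < b" for i using inv[of i] by (metis order_le_less)
      then have "a + real i * \<kappa> < b" for i using inv[of i] by (meson le_less_trans)
      moreover obtain n where "b - a < real n * \<kappa>" using reals_Archimedean3[OF \<kappa>] by blast
      ultimately show False by (metis add.commute less_asym less_diff_eq)
    qed
    define m where "m = (LEAST m. x m = b)"
    have m: "x m = b" unfolding m_def using \<open>\<exists>m. x m = b\<close> by (rule LeastI_ex)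
    have less: "x i < b" if "i < m" for i
      using not_less_Least[of i "\<lambda>m. x m = b"] that inv[of i] by (auto simp: m_def)
    have "(SUP t\<in>{x i..x (Suc i)}. infnorm (u t - l i t)) \<le> \<epsilon>"
      if "i < m" "solves_ivp f (x i) (x (Suc i)) (y i) u" for i u
      using step[of i] inv[of i] less[of i] that
      by (intro cSUP_least) (auto simp: infnorm_sub)
    then have "\<exists>m. x 0 = a \<and> (\<forall>i<m. x i < x (Suc i)) \<and> x m = b \<and>
          (\<forall>i<m. \<forall>z. solves_ivp f (x i) (x (Suc i)) (y i) z \<longrightarrow>
             (SUP t\<in>{x i..x (Suc i)}. infnorm (z t - l i t)) \<le> \<epsilon>)"
      using init m step(1) inv less by (intro exI[of _ m]) auto
    then show "let x = (\<lambda>i. fst (adapt_mesh f a b \<eta> r \<beta> \<phi> h \<epsilon> i));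
         y = (\<lambda>i. snd (adapt_mesh f a b \<eta> r \<beta> \<phi> h \<epsilon> i));
         l = (\<lambda>i. local_approx f b r \<beta> \<phi> h \<epsilon> (x i) (y i))
     in \<exists>m. x 0 = a \<and> (\<forall>i<m. x i < x (Suc i)) \<and> x m = b \<and>
          (\<forall>i<m. \<forall>z. solves_ivp f (x i) (x (Suc i)) (y i) z \<longrightarrow>
             (SUP t\<in>{x i..x (Suc i)}. infnorm (z t - l i t)) \<le> \<epsilon>)"
      by (simp only: Let_def x_def y_def l_def)
  qed
qed

end
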